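(* Let $X$ be a smooth irreducible complex affine variety with coordinate ring $\mathbb C[X]$, let $\mathfrak a=(f_1,\dots,f_r)\subset\mathbb C[X]$ be a nonzero ideal, and let $P\in V(\mathfrak a)$ be a closed point. Then $$\operatorname{lct}_P(\mathfrak a)\le \operatorname{rk}^G(P,\mathfrak a).$$
   Context: The log canonical threshold of $\mathfrak a=(f_1,\dots,f_r)$ at $P$ is $$\operatorname{lct}_P(\mathfrak a)=\sup\Big\{s>0 \;\Big|\; \frac{1}{(\sum_{i=1}^r|f_i|^2)^s}\text{ is integrable around }P\Big\}$$ (integrable on some neighbourhood of $P$ in the complex manifold $X$, with respect to Lebesgue measure in local holomorphic coordinates). Let $n=\dim X$, let $\mathcal O_P$ be the local ring of $X$ at $P$ and $\mathfrak m_P$ its maximal ideal. A system of local parameters at $P$ is $T=\{x_1,\dots,x_n\}$ with $x_i\in\mathfrak m_P$ whose images form a basis of $\mathfrak m_P/\mathfrak m_P^2$; then $\mathcal O_P\subset\mathbb C\{x_1,\dots,x_n\}$, the ring of convergent power series. For $\lambda=(\lambda_1,\dots,\lambda_n)\in\mathbb Z_{\ge0}^n$ and $f\in\mathbb C\{x_1,\dots,x_n\}$, let $\operatorname{val}^T_\lambda(f)$ be the largest $k$ such that $f(t^{\lambda_1}x_1,\dots,t^{\lambda_n}x_n)=t^kg(x_1,\dots,x_n,t)$ for some $g\in\mathbb C\{x_1,\dots,x_n,t\}$ (with $\operatorname{val}^T_\lambda(0)=+\infty$). For a nonzero ideal $\mathfrak a$ put $\operatorname{ord}^T_\lambda(\mathfrak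 a)=\min\{\operatorname{val}^T_\lambda(f)\mid f\in\mathfrak a\}$. The $T$-stable rank is $$\operatorname{rk}^T(P,\mathfrak a)=\inf_\lambda \frac{\sum_{i=1}^n\lambda_i}{\operatorname{ord}^T_\lambda(\mathfrak a)},$$ the infimum over nonzero $\lambda\in\mathbb Z^n_{\ge0}$ (a quotient with zero denominator counts as $+\infty$), and the $G$-stable rank is $\operatorname{rk}^G(P,\mathfrak a)=\inf_T\operatorname{rk}^T(P,\mathfrak a)$, the infimum over all systems of local parameters $T$ at $P$. *)

theory Defs
  imports "HOL-Analysis.Analysis" "HOL-Algebra.Ideal"
begin

section \<open>Affine varieties\<close>

inductive_set poly_fun :: "(complex^'m \<Rightarrow> complex) set" where
  const: "(\<lambda>_. c) \<in> poly_fun"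
| coord: "(\<lambda>x. x $ i) \<in> poly_fun"
| add: "p \<in> poly_fun \<Longrightarrow> q \<in> poly_fun \<Longrightarrow> (\<lambda>x. p x + q x) \<in> poly_fun"
| mult: "p \<in> poly_fun \<Longrightarrow> q \<in> poly_fun \<Longrightarrow> (\<lambda>x. p x * q x) \<in> poly_fun"

definition zariski_closed :: "(complex^'m) set \<Rightarrow> bool" where
  "zariski_closed X \<longleftrightarrow> (\<exists>S \<subseteq> poly_fun. X = {x. \<forall>p\<in>S. p x = 0})"

definition irreducible_closed :: "(complex^'m) set \<Rightarrow> bool" where
  "irreducible_closed X \<longleftrightarrow> zariski_closed X \<and> X \<noteq> {} \<and>
     (\<forall>Y Z. zariski_closed Y \<and> zariski_closed Z \<and> X \<subseteq> Y \<union> Z \<longrightarrow> X \<subseteq> Y \<or> X \<subseteq> Z)"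

definition variety_dim :: "(complex^'m) set \<Rightarrow> enat" where
  "variety_dim X = Sup {enat k | k. \<exists>Z :: nat \<Rightarrow> (complex^'m) set.
     (\<forall>i\<le>k. irreducible_closed (Z i) \<and> Z i \<subseteq> X) \<and> (\<forall>i<k. Z i \<subset> Z (Suc i))}"

text \<open>
  The coordinate ring consists of the restrictions of polynomial functions to \<open>X\<close>; a function
  on \<open>X\<close> is represented by its extension by zero, so that equality on \<open>X\<close> is equality.
\<close>

definition coordinate_ring :: "(complex^'m) set \<Rightarrow> (complex^'m \<Rightarrow> complex) ring" where
  "coordinate_ring X =
    \<lparr>carrier = {\<lambda>x. if x \<in> X then p x else 0 | p. p \<in> poly_fun},
     mult = (\<lambda>f g x. f x * g x),
     one = (\<lambda>x. if x \<in> X then 1 else 0),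
     zero = (\<lambda>_. 0),
     add = (\<lambda>f g x. f x + g x)\<rparr>"

lemma carrier_coordinate_ring:
  "carrier (coordinate_ring X) = {\<lambda>x. if x \<in> X then p x else 0 | p. p \<in> poly_fun}"
  by (simp add: coordinate_ring_def)

lemma cring_coordinate_ring: "cring (coordinate_ring (X :: (complex^'m) set))"
proof -
  let ?C = "{\<lambda>x. if x \<in> X then p x else 0 | p. p \<in> poly_fun} :: (complex^'m \<Rightarrow> complex) set"
  have inC: "(\<lambda>x. if x \<in> X then p x else 0) \<in> ?C" if "p \<in> poly_fun" for p
    using that by (intro CollectI exI conjI) (rule refl)
  have add: "(\<lambda>x. f x + g x) \<in> ?C" and mult: "(\<lambda>x. f x * g x) \<in> ?C"
    if "f \<in> ?C" "g \<in> ?C" for f g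
  proof -
    from that obtain p q where pq: "p \<in> poly_fun" "q \<in> poly_fun"
      "f = (\<lambda>x. if x \<in> X then p x else 0)" "g = (\<lambda>x. if x \<in> X then q x else 0)" by blast
    have "(\<lambda>x. f x + g x) = (\<lambda>x. if x \<in> X then p x + q x else 0)"
      "(\<lambda>x. f x * g x) = (\<lambda>x. if x \<in> X then p x * q x else 0)"
      by (auto simp: pq)
    note eqs = this
    show "(\<lambda>x. f x + g x) \<in> ?C"
      unfolding eqs(1) by (rule inC[OF poly_fun.add[OF pq(1,2)]])
    show "(\<lambda>x. f x * g x) \<in> ?C"
      unfolding eqs(2) by (rule inC[OF poly_fun.mult[OF pq(1,2)]])
  qed
  have one: "(\<lambda>x. if x \<in> X then 1 else 0) \<in> ?C"
    by (rule inC[OF poly_fun.const])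
  have zero: "(\<lambda>_. 0) \<in> ?C"
    using inC[OF poly_fun.const[of 0]] by simp
  have minus: "(\<lambda>x. - f x) \<in> ?C" if "f \<in> ?C" for f
  proof -
    have "(\<lambda>x. if x \<in> X then - 1 else 0) \<in> ?C"
      by (rule inC[OF poly_fun.const])
    from mult[OF this that] have "(\<lambda>x. (if x \<in> X then - 1 else 0) * f x) \<in> ?C" .
    moreover have "(\<lambda>x. (if x \<in> X then - 1 else 0) * f x) = (\<lambda>x. - f x)"
      using that by auto
    ultimately show ?thesis by simp
  qed
  have "abelian_group (coordinate_ring X)"
  proof (rule abelian_groupI; unfold coordinate_ring_def, simp_all only: ring_record_simps)
    fix f assume "f \<in> ?C"
    then show "\<exists>g\<in>?C. (\<lambda>x. g x + f x) = (\<lambda>_. 0)"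
      using minus[of f] by (intro bexI[of _ "\<lambda>x. - f x"]) auto
  qed (use add zero in \<open>auto simp: algebra_simps\<close>)
  moreover have "comm_monoid (coordinate_ring X)"
    by (rule comm_monoidI; unfold coordinate_ring_def, simp_all only: ring_record_simps monoid.simps)
      (use mult one in \<open>auto simp: algebra_simps\<close>)
  ultimately show ?thesis
    by (rule cringI) (simp add: coordinate_ring_def algebra_simps)
qed

section \<open>The local ring at a point\<close>

text \<open>
  Elements of the local ring are represented by arbitrary functions that agree with a fraction of
  polynomials on a Zariski neighbourhood of \<open>P\<close> in \<open>X\<close>; two functions represent the same
  element iff they satisfy \<open>germ_eq\<close>. The sets below are saturated under \<open>germ_eq\<close>.
\<close>

definition germ_eq ::
  "(complex^'m) set \<Rightarrow> complex^'m \<Rightarrow> (complex^'m \<Rightarrow> complex) \<Rightarrow> (complex^'m \<Rightarrow> complex) \<Rightarrow> bool" where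
  "germ_eq X P f g \<longleftrightarrow> (\<exists>h\<in>poly_fun. h P \<noteq> 0 \<and> (\<forall>x\<in>X. h x \<noteq> 0 \<longrightarrow> f x = g x))"

definition local_ring :: "(complex^'m) set \<Rightarrow> complex^'m \<Rightarrow> (complex^'m \<Rightarrow> complex) set" where
  "local_ring X P =
     {f. \<exists>p\<in>poly_fun. \<exists>q\<in>poly_fun. q P \<noteq> 0 \<and> germ_eq X P f (\<lambda>x. p x / q x)}"

definition max_ideal :: "(complex^'m) set \<Rightarrow> complex^'m \<Rightarrow> (complex^'m \<Rightarrow> complex) set" where
  "max_ideal X P = {f \<in> local_ring X P. f P = 0}"

definition max_ideal_sq :: "(complex^'m) set \<Rightarrow> complex^'m \<Rightarrow> (complex^'m \<Rightarrow> complex) set" where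
  "max_ideal_sq X P = {f. \<exists>(k::nat) u v. (\<forall>j<k. u j \<in> max_ideal X P \<and> v j \<in> max_ideal X P) \<and>
     germ_eq X P f (\<lambda>x. \<Sum>j<k. u j x * v j x)}"

text \<open>The family \<open>(x i)\<close>, \<open>i \<in> I\<close>, induces a basis of the cotangent space.\<close>

definition cotangent_basis ::
  "(complex^'m) set \<Rightarrow> complex^'m \<Rightarrow> 'i set \<Rightarrow> ('i \<Rightarrow> complex^'m \<Rightarrow> complex) \<Rightarrow> bool" where
  "cotangent_basis X P I x \<longleftrightarrow> finite I \<and> (\<forall>i\<in>I. x i \<in> max_ideal X P) \<and>
     (\<forall>c :: 'i \<Rightarrow> complex. (\<lambda>q. \<Sum>i\<in>I. c i * x i q) \<in> max_ideal_sq X P \<longrightarrow> (\<forall>i\<in>I. c i = 0)) \<and>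
     (\<forall>f\<in>max_ideal X P. \<exists>c :: 'i \<Rightarrow> complex. (\<lambda>q. f q - (\<Sum>i\<in>I. c i * x i q)) \<in> max_ideal_sq X P)"

text \<open>
  Smoothness at every closed point: the cotangent space has dimension \<open>dim X\<close>, which for an
  irreducible variety is also the Krull dimension of the local ring.
\<close>

definition smooth_irreducible_affine_variety :: "(complex^'m) set \<Rightarrow> bool" where
  "smooth_irreducible_affine_variety X \<longleftrightarrow> irreducible_closed X \<and>
     (\<forall>P\<in>X. \<exists>(n::nat) x. variety_dim X = enat n \<and> cotangent_basis X P {..<n} x)"

section \<open>Convergent power series\<close>

text \<open>
  A power series in the variables \<open>'v\<close> is given by its coefficients, indexed by multi-exponents.
\<close>

type_synonym 'v power_series = "('v \<Rightarrow> nat) \<Rightarrow> complex"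

definition ps_convergent :: "('v::finite) power_series \<Rightarrow> bool" where
  "ps_convergent F \<longleftrightarrow> (\<exists>r>0. (\<lambda>\<alpha>. norm (F \<alpha>) * r ^ (\<Sum>i\<in>UNIV. \<alpha> i)) summable_on UNIV)"

definition ps_eval :: "('v::finite) power_series \<Rightarrow> ('v \<Rightarrow> complex) \<Rightarrow> complex" where
  "ps_eval F z = (\<Sum>\<^sub>\<infinity>\<alpha>\<in>UNIV. F \<alpha> * (\<Prod>i\<in>UNIV. z i ^ \<alpha> i))"

text \<open>
  \<open>F(t^lam x) = t^k G(x, t)\<close> is stated as an equality of germs at the origin. \<open>G\<close> has variables
  \<open>'v option\<close>, where \<open>None\<close> stands for \<open>t\<close>. The supremum is attained for \<open>F \<noteq> 0\<close> and is
  \<open>\<infinity>\<close> for \<open>F = 0\<close>.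
\<close>

definition ps_val :: "('v::finite \<Rightarrow> nat) \<Rightarrow> 'v power_series \<Rightarrow> enat" where
  "ps_val lam F = Sup {enat k | k. \<exists>G :: 'v option power_series. ps_convergent G \<and>
     (\<exists>\<epsilon>>0. \<forall>x t. (\<forall>i. norm (x i) < \<epsilon>) \<and> norm t < \<epsilon> \<longrightarrow>
        ps_eval F (\<lambda>i. t ^ lam i * x i) = t ^ k * ps_eval G (case_option t x))}"

section \<open>The G-stable rank\<close>

definition local_parameters ::
  "(complex^'m) set \<Rightarrow> complex^'m \<Rightarrow> ('n::finite \<Rightarrow> complex^'m \<Rightarrow> complex) \<Rightarrow> bool" where
  "local_parameters X P T \<longleftrightarrow> cotangent_basis X P UNIV T"

text \<open>
  \<open>is_expansion X P T f F\<close>: the inclusion of the local ring into the convergent power series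
  in the local parameters \<open>T\<close> sends \<open>f\<close> to \<open>F\<close>.
\<close>

definition is_expansion ::
  "(complex^'m) set \<Rightarrow> complex^'m \<Rightarrow> ('n::finite \<Rightarrow> complex^'m \<Rightarrow> complex) \<Rightarrow>
    (complex^'m \<Rightarrow> complex) \<Rightarrow> 'n power_series \<Rightarrow> bool" where
  "is_expansion X P T f F \<longleftrightarrow> ps_convergent F \<and>
     (\<exists>U. open U \<and> P \<in> U \<and> (\<forall>q\<in>U \<inter> X. f q = ps_eval F (\<lambda>i. T i q)))"

definition ideal_ord ::
  "(complex^'m) set \<Rightarrow> complex^'m \<Rightarrow> ('n::finite \<Rightarrow> complex^'m \<Rightarrow> complex) \<Rightarrow> ('n \<Rightarrow> nat) \<Rightarrow>
    (complex^'m \<Rightarrow> complex) set \<Rightarrow> enat" where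
  "ideal_ord X P T lam \<aa> = (INF F\<in>{F. \<exists>f\<in>\<aa>. is_expansion X P T f F}. ps_val lam F)"

text \<open>In \<open>ennreal\<close>, \<open>a / 0 = \<infinity>\<close> for \<open>a \<noteq> 0\<close>, and the numerator below is nonzero.\<close>

definition T_stable_rank ::
  "(complex^'m) set \<Rightarrow> complex^'m \<Rightarrow> ('n::finite \<Rightarrow> complex^'m \<Rightarrow> complex) \<Rightarrow>
    (complex^'m \<Rightarrow> complex) set \<Rightarrow> ennreal" where
  "T_stable_rank X P T \<aa> =
     (INF lam\<in>{lam. \<exists>i. lam i \<noteq> 0}. of_nat (\<Sum>i\<in>UNIV. lam i) / ennreal_of_enat (ideal_ord X P T lam \<aa>))"

text \<open>The type argument \<open>'n\<close> indexes the local parameters; it is meant to have \<open>dim X\<close> elements.\<close>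

definition G_stable_rank ::
  "'n::finite itself \<Rightarrow> (complex^'m) set \<Rightarrow> complex^'m \<Rightarrow> (complex^'m \<Rightarrow> complex) set \<Rightarrow> ennreal" where
  "G_stable_rank _ X P \<aa> =
     (INF T\<in>{T :: 'n \<Rightarrow> complex^'m \<Rightarrow> complex. local_parameters X P T}. T_stable_rank X P T \<aa>)"

section \<open>The log canonical threshold\<close>

text \<open>
  Local holomorphic coordinates are given by their inverse: a holomorphic immersion \<open>\<phi>\<close> that maps
  an open set \<open>U\<close> homeomorphically onto an open neighbourhood of \<open>P\<close> in \<open>X\<close>.
\<close>

definition holomorphic_chart ::
  "(complex^'m) set \<Rightarrow> complex^'m \<Rightarrow> (complex^'n) set \<Rightarrow> (complex^'n \<Rightarrow> complex^'m) \<Rightarrow> bool" where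
  "holomorphic_chart X P U \<phi> \<longleftrightarrow> open U \<and>
     (\<forall>z\<in>U. \<exists>D. (\<phi> has_derivative D) (at z) \<and> (\<forall>c v. D (c *s v) = c *s D v) \<and> inj D) \<and>
     openin (top_of_set X) (\<phi> ` U) \<and> P \<in> \<phi> ` U \<and> (\<exists>\<psi>. homeomorphism U (\<phi> ` U) \<phi> \<psi>)"

text \<open>
  The integrand takes values in \<open>[0, \<infinity>]\<close>, with value \<open>\<infinity>\<close> at the common zeros of the \<open>f i\<close>.
  It is Borel measurable on \<open>U\<close> for continuous \<open>f i\<close>, so integrability is finiteness of the integral.
  Integrability on a small neighbourhood does not depend on the coordinates.
\<close>

definition locally_integrable_power ::
  "'n::finite itself \<Rightarrow> (complex^'m) set \<Rightarrow> complex^'m \<Rightarrow> nat \<Rightarrow> (nat \<Rightarrow> complex^'m \<Rightarrow> complex) \<Rightarrow>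
    real \<Rightarrow> bool" where
  "locally_integrable_power _ X P r f s \<longleftrightarrow>
     (\<exists>(U :: (complex^'n) set) \<phi>. holomorphic_chart X P U \<phi> \<and>
        (\<integral>\<^sup>+z\<in>U. 1 / ennreal ((\<Sum>i<r. (norm (f i (\<phi> z)))\<^sup>2) powr s) \<partial>lborel) < \<infinity>)"

definition lct ::
  "'n::finite itself \<Rightarrow> (complex^'m) set \<Rightarrow> complex^'m \<Rightarrow> nat \<Rightarrow> (nat \<Rightarrow> complex^'m \<Rightarrow> complex) \<Rightarrow>
    ennreal" where
  "lct n X P r f = (SUP s\<in>{s. s > 0 \<and> locally_integrable_power n X P r f s}. ennreal s)"

end

theory Submission
  imports Defs "HOL-Complex_Analysis.Cauchy_Integral_Formula" "HOL-Real_Asymp.Real_Asymp"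
begin

text \<open>
  Fix \<open>T\<close> and \<open>\<lambda>\<close>, and let \<open>k \<le> ord \<aa>\<close>. The local parameters restrict to holomorphic coordinates
  \<open>y\<close> on a neighbourhood of \<open>P\<close>: since the ambient coordinate functions lie in the span of \<open>T\<close>
  modulo \<open>\<mm>\<^sup>2\<close>, the differential of \<open>T\<close> along any holomorphic chart is injective. Each generator
  expands in a power series \<open>F\<close> in \<open>y\<close>, and \<open>F(t^\<lambda> x) = t^k G(x, t)\<close> gives \<open>|f| \<le> C t^k\<close> on the box
  \<open>|y\<^sub>i| < \<epsilon> t^\<lambda>\<^sub>i\<close>, whose volume is of order \<open>t^(2 \<Sum>\<lambda>\<^sub>i)\<close>. Hence the integral of
  \<open>(\<Sum>|f|\<^sup>2)^(-s)\<close> is at least a constant times \<open>t^(2 \<Sum>\<lambda>\<^sub>i - 2 k s)\<close>, and letting \<open>t \<rightarrow> 0\<close> forces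
  \<open>k s \<le> \<Sum>\<lambda>\<^sub>i\<close>.
\<close>

section \<open>Separately holomorphic functions on a polydisc\<close>

text \<open>A chart only has a complex-linear derivative at each point; nothing says that the
  derivative varies continuously, as the inverse function theorem requires. Also, the order of the
  ideal is an infimum over expansions, so it bounds a generator only once that generator is known to
  have one. Both gaps are closed by reduction to one variable: Cauchy estimates on slices make
  partial derivatives separately holomorphic, hence continuous, and Taylor expansion in one variable
  after another yields a convergent series.

  The volume comparison is needed in one direction only. The part \<open>S\<close> of the chart over
  the box \<open>Q\<close> must not be too small, and a Lipschitz bound for the parameter map gives
  \<open>vol Q \<le> K * vol S\<close> with \<open>K\<close> independent of \<open>t\<close>; no
  Jacobian determinant enters. All of this takes place in the chart that witnesses integrability, so
  charts are never compared.\<close>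

definition polydisc :: "real \<Rightarrow> (complex^'n) set" where
  "polydisc R = {z. \<forall>i. norm (z $ i) < R}"

definition vupd :: "'n \<Rightarrow> complex^'n \<Rightarrow> complex \<Rightarrow> complex^'n" where
  "vupd j z w = (\<chi> i. if i = j then w else z $ i)"

lemma vupd_nth [simp]: "vupd j z w $ i = (if i = j then w else z $ i)"
  by (simp add: vupd_def)

lemma vupd_same [simp]: "vupd j z (z $ j) = z"
  by (simp add: vec_eq_iff)

lemma vupd_vupd [simp]: "vupd j (vupd j z u) w = vupd j z w"
  by (simp add: vec_eq_iff)

lemma vupd_commute: "i \<noteq> j \<Longrightarrow> vupd j (vupd i z u) w = vupd i (vupd j z w) u"
  by (simp add: vec_eq_iff)

lemma vupd_polydisc: "z \<in> polydisc R \<Longrightarrow> norm w < R \<Longrightarrow> vupd j z w \<in> polydisc R"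
  by (auto simp: polydisc_def)

lemma polydiscD: "z \<in> polydisc R \<Longrightarrow> norm (z $ i) < R"
  by (simp add: polydisc_def)

lemma polydisc_mono: "r \<le> R \<Longrightarrow> polydisc r \<subseteq> polydisc R"
  by (auto simp: polydisc_def intro: less_le_trans)

lemma open_polydisc: "open (polydisc R :: (complex^'n) set)"
proof -
  have "polydisc R = (\<Inter>i::'n. {z. norm (z $ i) < R})"
    by (auto simp: polydisc_def)
  moreover have "open {z :: complex^'n. norm (z $ i) < R}" for i
    by (intro open_Collect_less continuous_intros)
  ultimately show ?thesis by (simp add: open_INT)
qed

lemma polydisc_shrink:
  fixes z :: "complex^'n"
  assumes "z \<in> polydisc R"
  obtains r where "0 < r" "r < R" "z \<in> polydisc r"
proof -
  define M where "M = Max (range (\<lambda>i. norm (z $ i)))"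
  have le: "norm (z $ i) \<le> M" for i by (simp add: M_def)
  have "M \<in> range (\<lambda>i. norm (z $ i))" unfolding M_def by (rule Max_in) auto
  then have "M < R" using assms by (auto simp: polydisc_def)
  moreover have "0 \<le> M" using le[of undefined] by (meson norm_ge_zero order_trans)
  moreover have "norm (z $ i) < (M + R) / 2" for i using le[of i] \<open>M < R\<close> by (simp add: field_simps)
  ultimately show ?thesis
    by (intro that[of "(M + R) / 2"]) (auto simp: polydisc_def)
qed

lemma compact_closed_polydisc: "compact {z :: complex^'n. \<forall>i. norm (z $ i) \<le> r}"
proof (rule compact_eq_bounded_closed[THEN iffD2], intro conjI)
  have "norm z \<le> (\<Sum>i\<in>(UNIV::'n set). r)" if "\<forall>i. norm (z $ i) \<le> r" for z :: "complex^'n"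
  proof -
    have "norm z \<le> (\<Sum>i\<in>UNIV. norm (z $ i))" unfolding norm_vec_def by (rule L2_set_le_sum) simp
    also have "\<dots> \<le> (\<Sum>i\<in>(UNIV::'n set). r)" by (rule sum_mono) (use that in simp)
    finally show ?thesis .
  qed
  then show "bounded {z :: complex^'n. \<forall>i. norm (z $ i) \<le> r}"
    by (auto simp: bounded_iff)
  have "{z :: complex^'n. \<forall>i. norm (z $ i) \<le> r} = (\<Inter>i. {z. norm (z $ i) \<le> r})" by auto
  moreover have "closed {z :: complex^'n. norm (z $ i) \<le> r}" for i
    by (intro closed_Collect_le continuous_intros)
  ultimately show "closed {z :: complex^'n. \<forall>i. norm (z $ i) \<le> r}" by auto
qed

text \<open>Joint continuity is built in: it gives bounds on closed polydiscs by compactness, and no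
  theorem of Hartogs type is required. For \<open>R \<le> 0\<close> the polydisc is empty and the
  predicate holds trivially.\<close>

definition separately_holomorphic :: "real \<Rightarrow> (complex^'n \<Rightarrow> complex) \<Rightarrow> bool" where
  "separately_holomorphic R f \<longleftrightarrow> continuous_on (polydisc R) f \<and>
     (\<forall>z\<in>polydisc R. \<forall>j. (\<lambda>w. f (vupd j z w)) holomorphic_on ball 0 R)"

definition partial_deriv :: "'n \<Rightarrow> (complex^'n \<Rightarrow> complex) \<Rightarrow> complex^'n \<Rightarrow> complex" where
  "partial_deriv j f z = deriv (\<lambda>w. f (vupd j z w)) (z $ j)"

lemma partial_deriv_vupd: "partial_deriv j f (vupd j z w) = deriv (\<lambda>w. f (vupd j z w)) w"
  by (simp add: partial_deriv_def)

lemma continuous_vupd: 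
  "continuous_on S u \<Longrightarrow> continuous_on S g \<Longrightarrow> continuous_on S (\<lambda>z. vupd j (g z) (u z))"
  unfolding vupd_def
proof (rule continuous_on_vec_lambda)
  fix i assume "continuous_on S u" "continuous_on S g"
  then show "continuous_on S (\<lambda>z. if i = j then u z else g z $ i)"
    by (cases "i = j") (auto intro!: continuous_intros)
qed

text \<open>Weierstrass's theorem applied to slices. Each smaller polydisc may have its own
  sequence, because the intended approximants are difference quotients, which shift the argument and
  so are holomorphic only on a smaller polydisc.\<close>

lemma separately_holomorphic_limit:
  fixes g :: "complex^'n \<Rightarrow> complex"
  assumes "\<And>r. 0 < r \<Longrightarrow> r < R \<Longrightarrow> \<exists>Q. (\<forall>m::nat. separately_holomorphic r (Q m)) \<and>
    uniform_limit (polydisc r) Q g sequentially"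
  shows "separately_holomorphic R g"
  unfolding separately_holomorphic_def
proof (intro conjI ballI allI)
  have "isCont g z" if z: "z \<in> polydisc R" for z
  proof -
    obtain r where r: "0 < r" "r < R" "z \<in> polydisc r" using polydisc_shrink[OF z] .
    then obtain Q where Q: "\<And>m::nat. separately_holomorphic r (Q m)"
      "uniform_limit (polydisc r) Q g sequentially" using assms by metis
    have "continuous_on (polydisc r) g"
      by (rule uniform_limit_theorem[OF _ Q(2)]) 
        (use Q(1) in \<open>auto simp: separately_holomorphic_def\<close>)
    then show ?thesis using r open_polydisc continuous_on_eq_continuous_at by blast
  qed
  then show "continuous_on (polydisc R) g"
    by (simp add: continuous_at_imp_continuous_on)
next
  fix z :: "complex^'n" and j assume z: "z \<in> polydisc R"
  have "(\<lambda>w. g (vupd j z w)) field_differentiable at w0" if w0: "w0 \<in> ball 0 R" for w0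
  proof -
    have z': "vupd j z w0 \<in> polydisc R" using z w0 by (intro vupd_polydisc) auto
    obtain r where r: "0 < r" "r < R" "vupd j z w0 \<in> polydisc r" using polydisc_shrink[OF z'] .
    then obtain Q where Q: "\<And>m::nat. separately_holomorphic r (Q m)"
      "uniform_limit (polydisc r) Q g sequentially" using assms by metis
    have "(\<lambda>w. g (vupd j z w)) holomorphic_on ball 0 r"
    proof (rule holomorphic_uniform_sequence[where f = "\<lambda>m w. Q m (vupd j z w)"])
      show "(\<lambda>w. Q m (vupd j z w)) holomorphic_on ball 0 r" for m
      proof -
        have "(\<lambda>w. Q m (vupd j (vupd j z w0) w)) holomorphic_on ball 0 r"
          using Q(1)[of m] r(3) unfolding separately_holomorphic_def by blast
        then show ?thesis by simp
      qed
      fix x :: complex assume "x \<in> ball 0 r"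
      then obtain d where d: "d > 0" "cball x d \<subseteq> ball 0 r"
        using open_contains_cball open_ball by meson
      have "vupd j z w \<in> polydisc r" if "w \<in> cball x d" for w
        using vupd_polydisc[OF r(3), of w j] d that by auto
      then have "uniform_limit (cball x d) (\<lambda>m w. Q m (vupd j z w)) (\<lambda>w. g (vupd j z w)) sequentially"
        using Q(2) unfolding uniform_limit_iff by (auto elim!: eventually_mono)
      with d show "\<exists>d>0. cball x d \<subseteq> ball 0 r \<and>
        uniform_limit (cball x d) (\<lambda>m w. Q m (vupd j z w)) (\<lambda>w. g (vupd j z w)) sequentially"
        by blast
    qed auto
    moreover have "w0 \<in> ball 0 r" using polydiscD[OF r(3), of j] by simp
    ultimately show ?thesis using holomorphic_on_imp_differentiable_at by blast
  qed
  then show "(\<lambda>w. g (vupd j z w)) holomorphic_on ball 0 R"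
    by (simp add: holomorphic_on_def field_differentiable_at_within)
qed

text \<open>Taylor expansion of first order, with the second derivative controlled by Cauchy's
  estimate on circles of radius \<open>\<delta>\<close>. The bound depends on \<open>h\<close> only
  through \<open>M\<close>, hence is uniform over all slices of one function. Of the margin
  \<open>2 * \<delta>\<close>, one half reaches the points near \<open>a\<close> and the other half
  the circles around them.\<close>

lemma difference_quotient_bound:
  fixes h :: "complex \<Rightarrow> complex"
  assumes hol: "h holomorphic_on ball 0 R" and a: "norm a < r" and \<delta>: "\<delta> > 0" "r + 2 * \<delta> < R"
    and M: "\<And>w. norm w \<le> r + 2 * \<delta> \<Longrightarrow> norm (h w) \<le> M" and \<eta>: "\<eta> \<noteq> 0" "norm \<eta> < \<delta>"
  shows "norm ((h (a + \<eta>) - h a) / \<eta> - deriv h a) \<le> 2 * M / \<delta>^2 * norm \<eta>"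
proof -
  have sub: "cball x \<delta> \<subseteq> cball 0 (r + 2 * \<delta>)" if "x \<in> ball a \<delta>" for x
  proof
    fix y assume "y \<in> cball x \<delta>"
    then have "norm (y - x) \<le> \<delta>" "norm (x - a) < \<delta>" using that by (auto simp: dist_norm norm_minus_commute)
    then show "y \<in> cball 0 (r + 2 * \<delta>)" using a norm_triangle_ineq[of "y - x" x] norm_triangle_ineq[of "x - a" a]
      by auto
  qed
  have sub': "cball 0 (r + 2 * \<delta>) \<subseteq> ball (0::complex) R" using \<delta> by auto
  have bnd: "norm ((deriv ^^ Suc 1) h x) \<le> 2 * M / \<delta>^2" if x: "x \<in> ball a \<delta>" for x
  proof -
    have "norm ((deriv ^^ 2) h x) \<le> fact 2 * M / \<delta>^2"
    proof (rule Cauchy_inequality[OF _ _ \<delta>(1)])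
      show "h holomorphic_on ball x \<delta>" "continuous_on (cball x \<delta>) h"
        using hol sub[OF x] sub' ball_subset_cball 
        by (meson holomorphic_on_subset subset_trans holomorphic_on_imp_continuous_on)+
      fix y assume "norm (x - y) = \<delta>"
      then have "y \<in> cball x \<delta>" by (simp add: dist_norm)
      then show "norm (h y) \<le> M" using sub[OF x] M by auto
    qed
    then show ?thesis by (simp add: numeral_2_eq_2)
  qed
  \<comment> \<open>This form of Taylor's estimate divides the remainder by \<open>fact 1\<close>,
    not by \<open>fact 2\<close>, so the bound for the second derivative reappears without being
    halved.\<close>
  have "norm ((deriv ^^ 0) h (a + \<eta>) - (\<Sum>i\<le>1. (deriv ^^ i) h a * ((a + \<eta>) - a) ^ i / fact i))
     \<le> 2 * M / \<delta>^2 * norm ((a + \<eta>) - a) ^ Suc 1 / fact 1"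
  proof (rule field_Taylor[where S = "ball a \<delta>" and f = "\<lambda>i. (deriv ^^ i) h"])
    fix i x assume "x \<in> ball a \<delta>"
    then have x: "x \<in> ball 0 R" using sub[of x] sub' \<delta> centre_in_cball[of x \<delta>] by (meson less_imp_le subsetD)
    have "(deriv ^^ i) h holomorphic_on ball 0 R" using hol by (rule holomorphic_higher_deriv) auto
    from holomorphic_derivI[OF this open_ball x]
    show "((deriv ^^ i) h has_field_derivative (deriv ^^ Suc i) h x) (at x within ball a \<delta>)"
      by (simp add: has_field_derivative_at_within)
  qed (use bnd \<delta> \<eta> in \<open>auto simp: dist_norm\<close>)
  then have "norm (h (a + \<eta>) - (h a + deriv h a * \<eta>)) \<le> 2 * M / \<delta>^2 * norm \<eta> ^ 2"
    by (simp add: numeral_2_eq_2)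
  then have "norm (h (a + \<eta>) - (h a + deriv h a * \<eta>)) / norm \<eta> \<le> 2 * M / \<delta>^2 * norm \<eta> ^ 2 / norm \<eta>"
    by (rule divide_right_mono) simp
  moreover have "(h (a + \<eta>) - h a) / \<eta> - deriv h a = (h (a + \<eta>) - (h a + deriv h a * \<eta>)) / \<eta>"
    using \<eta> by (simp add: field_simps)
  ultimately show ?thesis using \<eta> by (simp add: norm_divide power2_eq_square)
qed

lemma separately_holomorphic_mono:
  assumes "separately_holomorphic R f" "r \<le> R"
  shows "separately_holomorphic r f"
proof -
  have "ball (0::complex) r \<subseteq> ball 0 R" using assms by auto
  then show ?thesis using assms(1) polydisc_mono[OF assms(2)] unfolding separately_holomorphic_def
    by (meson continuous_on_subset holomorphic_on_subset subsetD)
qed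

text \<open>A slice in the shifted variable \<open>j\<close> is a slice of \<open>f\<close> composed
  with a translation; a slice in another variable is a slice of \<open>f\<close> through the shifted
  point.\<close>

lemma separately_holomorphic_shift:
  fixes f :: "complex^'n \<Rightarrow> complex"
  assumes f: "separately_holomorphic R f" and "norm \<eta> + r \<le> R"
  shows "separately_holomorphic r (\<lambda>z. f (vupd j z (z $ j + \<eta>)))"
proof -
  have le: "r \<le> R" using assms(2) norm_ge_zero[of \<eta>] by linarith
  have n: "norm (w + \<eta>) < R" if "norm w < r" for w
    using assms(2) that norm_triangle_ineq[of w \<eta>] by linarith
  have sub: "vupd j z (z $ j + \<eta>) \<in> polydisc R" if "z \<in> polydisc r" for z
    using that polydisc_mono[OF le] by (intro vupd_polydisc n) (auto simp: polydisc_def)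
  have "continuous_on (polydisc r) (\<lambda>z. f (vupd j z (z $ j + \<eta>)))"
    by (rule continuous_on_compose2[where s = "polydisc r" and t = "polydisc R" and g = f])
      (use f sub in \<open>auto simp: separately_holomorphic_def intro!: continuous_vupd continuous_intros\<close>)
  moreover have "(\<lambda>w. f (vupd j (vupd i z w) (vupd i z w $ j + \<eta>))) holomorphic_on ball 0 r"
    if z: "z \<in> polydisc r" for z i
  proof (cases "i = j")
    case True
    have h: "(\<lambda>w. f (vupd j z w)) holomorphic_on ball 0 R"
      using f z polydisc_mono[OF le] unfolding separately_holomorphic_def by blast
    have "(\<lambda>w. f (vupd j z w)) \<circ> (\<lambda>w. w + \<eta>) holomorphic_on ball 0 r"
      by (rule holomorphic_on_compose_gen[OF _ h]) (use n in \<open>auto intro!: holomorphic_intros\<close>)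
    then show ?thesis using True by (simp add: o_def)
  next
    case False
    have "(\<lambda>w. f (vupd i (vupd j z (z $ j + \<eta>)) w)) holomorphic_on ball 0 R"
      using f sub[OF z] unfolding separately_holomorphic_def by blast
    then have "(\<lambda>w. f (vupd i (vupd j z (z $ j + \<eta>)) w)) holomorphic_on ball 0 r"
      by (rule holomorphic_on_subset) (use le in auto)
    then show ?thesis using False by (simp add: vupd_commute)
  qed
  ultimately show ?thesis by (simp add: separately_holomorphic_def)
qed

lemma separately_holomorphic_diff_divide:
  assumes "separately_holomorphic r f" "separately_holomorphic r g" "c \<noteq> 0"
  shows "separately_holomorphic r (\<lambda>z. (f z - g z) / c)"
  using assms unfolding separately_holomorphic_def
  by (auto intro!: continuous_intros holomorphic_intros)

lemma separately_holomorphic_bounded: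
  fixes f :: "complex^'n \<Rightarrow> complex"
  assumes f: "separately_holomorphic R f" and "r < R"
  obtains M where "M \<ge> 0" "\<And>z. \<forall>i. norm (z $ i) \<le> r \<Longrightarrow> norm (f z) \<le> M"
proof -
  have "continuous_on {z. \<forall>i. norm (z $ i) \<le> r} f"
    using f assms(2) unfolding separately_holomorphic_def
    by (auto elim!: continuous_on_subset simp: polydisc_def intro: le_less_trans)
  then have "bounded (f ` {z. \<forall>i. norm (z $ i) \<le> r})"
    using compact_closed_polydisc compact_continuous_image compact_imp_bounded by blast
  then obtain M where "\<forall>x \<in> f ` {z. \<forall>i. norm (z $ i) \<le> r}. norm x \<le> M" 
    by (auto simp: bounded_iff)
  then show ?thesis by (intro that[of "max 0 M"]) (auto simp: max.coboundedI2)
qed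

text \<open>The difference quotients converge uniformly because the Cauchy estimates bound the second
  derivative of each slice uniformly in the slice.\<close>

lemma separately_holomorphic_partial_deriv:
  fixes f :: "complex^'n \<Rightarrow> complex"
  assumes f: "separately_holomorphic R f"
  shows "separately_holomorphic R (partial_deriv j f)"
proof (rule separately_holomorphic_limit)
  fix r assume r: "0 < r" "r < R"
  \<comment> \<open>A third of the gap leaves room for the two steps of length
    \<open>\<delta>\<close> in the difference quotient bound, with strict inequality.\<close>
  define \<delta> where "\<delta> = (R - r) / 3"
  have \<delta>: "\<delta> > 0" "r + 2 * \<delta> < R" using r by (auto simp: \<delta>_def field_simps)
  obtain M where M: "M \<ge> 0" "\<And>z. \<forall>i. norm (z $ i) \<le> r + 2 * \<delta> \<Longrightarrow> norm (f z) \<le> M"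
    using separately_holomorphic_bounded[OF f \<delta>(2)] by blast
  \<comment> \<open>Any null sequence of nonzero increments would do; the summand 2 keeps even the
    term for \<open>m = 0\<close> strictly below \<open>\<delta>\<close>.\<close>
  define \<eta> where "\<eta> m = complex_of_real (\<delta> / (real m + 2))" for m :: nat
  have \<eta>: "\<eta> m \<noteq> 0" "norm (\<eta> m) = \<delta> / (real m + 2)" "norm (\<eta> m) < \<delta>" for m
  proof -
    have "\<delta> / (real m + 2) < \<delta> / 1" using \<delta> by (intro divide_strict_left_mono) auto
    moreover show "norm (\<eta> m) = \<delta> / (real m + 2)"
      unfolding \<eta>_def norm_of_real using \<delta> by auto
    moreover have "0 < \<delta> / (real m + 2)" using \<delta> by (intro divide_pos_pos) auto
    ultimately show "\<eta> m \<noteq> 0" "norm (\<eta> m) < \<delta>" by auto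
  qed
  define Q where "Q m z = (f (vupd j z (z $ j + \<eta> m)) - f z) / \<eta> m" for m z
  have "separately_holomorphic r (Q m)" for m
    unfolding Q_def
    by (intro separately_holomorphic_diff_divide separately_holomorphic_shift[OF f]
        separately_holomorphic_mono[OF f]) (use \<eta>[of m] \<delta> r in auto)
  moreover have "uniform_limit (polydisc r) Q (partial_deriv j f) sequentially"
  proof (rule uniform_limitI)
    fix e :: real assume e: "e > 0"
    have "(\<lambda>m. 2 * M / \<delta>^2 * (\<delta> / (real m + 2))) \<longlonglongrightarrow> 0" by real_asymp
    then have "\<forall>\<^sub>F m in sequentially. 2 * M / \<delta>^2 * (\<delta> / (real m + 2)) < e"
      using e order_tendstoD(2) by blast
    then show "\<forall>\<^sub>F m in sequentially. \<forall>z\<in>polydisc r. dist (Q m z) (partial_deriv j f z) < e"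
    proof (rule eventually_mono, intro ballI)
      fix m :: nat and z :: "complex^'n" assume m: "2 * M / \<delta>^2 * (\<delta> / (real m + 2)) < e" and z: "z \<in> polydisc r"
      have "norm (((\<lambda>w. f (vupd j z w)) (z $ j + \<eta> m) - (\<lambda>w. f (vupd j z w)) (z $ j)) / \<eta> m
          - deriv (\<lambda>w. f (vupd j z w)) (z $ j)) \<le> 2 * M / \<delta>^2 * norm (\<eta> m)"
      proof (rule difference_quotient_bound[where R = R and r = r])
        show "(\<lambda>w. f (vupd j z w)) holomorphic_on ball 0 R"
          using f z polydisc_mono[of r R] r unfolding separately_holomorphic_def by auto
        show "norm (f (vupd j z w)) \<le> M" if "norm w \<le> r + 2 * \<delta>" for w
          by (rule M(2)) (use that z \<delta> in \<open>auto simp: polydisc_def intro: less_imp_le less_le_trans\<close>,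
             smt (verit))
      qed (use \<eta> \<delta> z in \<open>auto simp: polydisc_def\<close>)
      then show "dist (Q m z) (partial_deriv j f z) < e"
        using m \<eta>(2)[of m] by (simp add: Q_def partial_deriv_def dist_norm)
    qed
  qed
  ultimately show "\<exists>Q. (\<forall>m::nat. separately_holomorphic r (Q m)) \<and>
    uniform_limit (polydisc r) Q (partial_deriv j f) sequentially" by blast
qed

lemma separately_holomorphic_funpow_partial_deriv:
  "separately_holomorphic R f \<Longrightarrow> separately_holomorphic R ((partial_deriv j ^^ k) f)"
  by (induction k) (auto intro: separately_holomorphic_partial_deriv)

lemma funpow_partial_deriv_vupd:
  "(partial_deriv j ^^ k) f (vupd j z w) = (deriv ^^ k) (\<lambda>w. f (vupd j z w)) w"
proof (induction k arbitrary: w)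
  case (Suc k)
  show ?case by (simp add: partial_deriv_vupd Suc)
qed simp

text \<open>This is the shape of a Taylor coefficient in the variable \<open>j\<close>: an iterated
  partial derivative at \<open>z $ j = 0\<close>, scaled by an inverse factorial. Setting a
  coordinate to 0 stays in the polydisc if \<open>R > 0\<close>; otherwise the polydisc is
  empty.\<close>

lemma separately_holomorphic_restrict:
  fixes f :: "complex^'n \<Rightarrow> complex"
  assumes f: "separately_holomorphic R f"
  shows "separately_holomorphic R (\<lambda>z. c * f (vupd j z 0))"
proof (cases "R > 0")
  case True
  have sub: "vupd j z 0 \<in> polydisc R" if "z \<in> polydisc R" for z
    by (rule vupd_polydisc[OF that]) (use True in auto)
  have "continuous_on (polydisc R) (\<lambda>z. f (vupd j z 0))"
    by (rule continuous_on_compose2[where s = "polydisc R" and t = "polydisc R" and g = f])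
      (use f sub in \<open>auto simp: separately_holomorphic_def intro!: continuous_vupd continuous_intros\<close>)
  moreover have "(\<lambda>w. f (vupd j (vupd i z w) 0)) holomorphic_on ball 0 R"
    if z: "z \<in> polydisc R" for z i
  proof (cases "i = j")
    case False
    then show ?thesis using f sub[OF z] by (simp add: vupd_commute separately_holomorphic_def)
  qed auto
  ultimately show ?thesis unfolding separately_holomorphic_def
    by (auto intro!: continuous_intros holomorphic_intros)
next
  case False
  then have "polydisc R = ({} :: (complex^'n) set)"
    using polydiscD order_le_less_trans[OF norm_ge_zero] by blast
  then show ?thesis by (simp add: separately_holomorphic_def)
qed

section \<open>Power series expansion, one variable at a time\<close>

abbreviation supported :: "'n set \<Rightarrow> ('n \<Rightarrow> nat) set" where
  "supported S \<equiv> {\<alpha>. \<forall>i. i \<notin> S \<longrightarrow> \<alpha> i = 0}"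

text \<open>Exponents remain functions on all of \<open>'n\<close> and are cut down by their
  support, so an induction over the variables never changes the type. This bijection separates the
  exponent of the new variable \<open>j\<close> from the rest.\<close>

lemma bij_betw_supported_insert:
  assumes "j \<notin> S"
  shows "bij_betw (\<lambda>(k, \<beta>). \<beta>(j := k)) (UNIV \<times> supported S) (supported (insert j S))"
  by (rule bij_betwI[where g = "\<lambda>\<alpha>. (\<alpha> j, \<alpha>(j := 0))"]) (use assms in \<open>auto simp: fun_eq_iff\<close>)

lemma prod_fun_upd_insert:
  fixes g :: "'n::finite \<Rightarrow> nat \<Rightarrow> 'a::comm_monoid_mult"
  assumes "j \<notin> S" "\<beta> \<in> supported S" "\<And>i. g i 0 = 1"
  shows "(\<Prod>i\<in>UNIV. g i ((\<beta>(j := k)) i)) = g j k * (\<Prod>i\<in>UNIV. g i (\<beta> i))"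
proof -
  have "\<beta> j = 0" using assms by auto
  have "(\<Prod>i\<in>UNIV. g i ((\<beta>(j := k)) i)) = g j k * (\<Prod>i\<in>UNIV - {j}. g i ((\<beta>(j := k)) i))"
    by (subst prod.remove[of _ j]) auto
  also have "(\<Prod>i\<in>UNIV - {j}. g i ((\<beta>(j := k)) i)) = (\<Prod>i\<in>UNIV - {j}. g i (\<beta> i))"
    by (rule prod.cong) auto
  also have "\<dots> = (\<Prod>i\<in>UNIV. g i (\<beta> i))"
    by (subst (2) prod.remove[of _ j]) (use \<open>\<beta> j = 0\<close> assms(3) in auto)
  finally show ?thesis .
qed

text \<open>A product of geometric series: splitting off one variable turns the sum into an iterated
  one, and nonnegativity allows summability to be checked iteratively.\<close>

lemma summable_geometric_supported:
  fixes q :: "'n::finite \<Rightarrow> real"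
  assumes "\<And>i. 0 \<le> q i" "\<And>i. q i < 1" "finite S"
  shows "(\<lambda>\<alpha>. \<Prod>i\<in>UNIV. q i ^ \<alpha> i) summable_on supported S"
  using assms(3)
proof (induction S)
  case empty
  have "supported {} = {\<lambda>_. 0}" by auto
  note s = this
  show ?case unfolding s by simp
next
  case (insert j S)
  let ?p = "\<lambda>\<alpha>. \<Prod>i\<in>UNIV. q i ^ \<alpha> i"
  obtain L where L: "(?p has_sum L) (supported S)" using insert by (auto simp: summable_on_def)
  have "(\<lambda>(k, \<beta>). q j ^ k * ?p \<beta>) summable_on (UNIV \<times> supported S)"
  proof (rule summable_on_SigmaI)
    show "((\<lambda>\<beta>. case (k, \<beta>) of (k, \<beta>) \<Rightarrow> q j ^ k * ?p \<beta>) has_sum q j ^ k * L) (supported S)" for k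
      using has_sum_cmult_right[OF L, of "q j ^ k"] by simp
    have "(\<lambda>k. q j ^ k) summable_on UNIV"
      by (rule norm_summable_imp_summable_on) (use assms in \<open>auto simp: norm_power intro!: summable_geometric\<close>)
    then show "(\<lambda>k. q j ^ k * L) summable_on UNIV" by (rule summable_on_cmult_left)
  qed (use assms in \<open>auto intro!: mult_nonneg_nonneg prod_nonneg\<close>)
  then have "(\<lambda>x. ?p ((\<lambda>(k, \<beta>). \<beta>(j := k)) x)) summable_on (UNIV \<times> supported S)"
  proof (rule iffD1[OF summable_on_cong, rotated])
    fix x assume "x \<in> (UNIV :: nat set) \<times> supported S"
    then obtain k \<beta> where x: "x = (k, \<beta>)" and \<beta>: "\<beta> \<in> supported S" by blast
    show "(case x of (k, \<beta>) \<Rightarrow> q j ^ k * ?p \<beta>) = ?p ((\<lambda>(k, \<beta>). \<beta>(j := k)) x)"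
      unfolding x prod.case
      using prod_fun_upd_insert[OF insert.hyps(2) \<beta>, where g = "\<lambda>i k. q i ^ k" and k = k] by simp
  qed
  then show ?case
    by (subst (asm) summable_on_reindex_bij_betw[OF bij_betw_supported_insert[OF insert.hyps(2)]])
qed

text \<open>Induction on the set of variables that \<open>f\<close> depends on: the Taylor coefficients of \<open>f\<close> in one variable
  are separately holomorphic functions of the remaining ones.\<close>

lemma separately_holomorphic_expansion_supported:
  fixes f :: "complex^'n \<Rightarrow> complex"
  assumes "finite S" "separately_holomorphic R f" "0 < r" "r < R"
    and "\<And>z. \<forall>i. norm (z $ i) \<le> r \<Longrightarrow> norm (f z) \<le> M"
    and "\<And>z z'. z \<in> polydisc R \<Longrightarrow> z' \<in> polydisc R \<Longrightarrow> \<forall>i\<in>S. z $ i = z' $ i \<Longrightarrow> f z = f z'"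
  shows "\<exists>F. (\<forall>\<alpha>. norm (F \<alpha>) \<le> M / r ^ (\<Sum>i\<in>UNIV. \<alpha> i)) \<and>
     (\<forall>z\<in>polydisc r. ((\<lambda>\<alpha>. F \<alpha> * (\<Prod>i\<in>UNIV. (z $ i) ^ \<alpha> i)) has_sum f z) (supported S))"
  using assms(1,2,5,6)
proof (induction S arbitrary: f M rule: finite_induct)
  case empty
  have "norm (f 0) \<le> M" using empty(2)[of 0] assms by simp
  moreover have "f 0 = f z" if "z \<in> polydisc r" for z
    using empty(3)[of 0 z] that assms polydisc_mono[of r R] by (auto simp: polydisc_def)
  moreover have "0 \<le> M" using calculation(1) norm_ge_zero order_trans by blast
  moreover define F where "F \<alpha> = (if \<alpha> = (\<lambda>_. 0) then f 0 else 0)" for \<alpha> :: "'n \<Rightarrow> nat"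
  have s: "supported {} = {\<lambda>_::'n. 0}" by auto
  have "((\<lambda>\<alpha>. F \<alpha> * (\<Prod>i\<in>UNIV. (z $ i) ^ \<alpha> i)) has_sum f z) (supported {})"
    if "z \<in> polydisc r" for z
    unfolding s by (rule has_sum_finiteI) (use calculation(2)[OF that] in \<open>auto simp: F_def\<close>)
  moreover have "norm (F \<alpha>) \<le> M / r ^ (\<Sum>i\<in>UNIV. \<alpha> i)" for \<alpha>
    using calculation(1,3) assms(3) by (simp add: F_def)
  ultimately show ?case by (intro exI[of _ F]) simp
next
  case (insert j S f M)
  note f = insert.prems(1) and M = insert.prems(2) and dep = insert.prems(3)
  have R: "0 < R" using assms by simp
  have "norm (f 0) \<le> M" using M[of 0] assms by simp
  then have M0: "0 \<le> M" using norm_ge_zero order_trans by blast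
  \<comment> \<open>Written with partial derivatives of \<open>f\<close> so that separate holomorphy
    is inherited; \<open>a_eq\<close> identifies it as the Taylor coefficient of the slice in
    direction \<open>j\<close>.\<close>
  define a where "a k z = inverse (fact k) * (partial_deriv j ^^ k) f (vupd j z 0)" for k z
  have a_eq: "a k z = (deriv ^^ k) (\<lambda>w. f (vupd j z w)) 0 / fact k" for k z
    by (simp add: a_def funpow_partial_deriv_vupd field_simps)
  have hol: "(\<lambda>w. f (vupd j z w)) holomorphic_on ball 0 R" if "z \<in> polydisc R" for z
    using f that by (auto simp: separately_holomorphic_def)
  have a_hol: "separately_holomorphic R (a k)" for k
    unfolding a_def by (intro separately_holomorphic_restrict separately_holomorphic_funpow_partial_deriv f)
  \<comment> \<open>Cauchy's estimate. The factor \<open>1 / r ^ k\<close> is passed into the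
    induction hypothesis through the bound \<open>M / r ^ k\<close>, so that the powers of
    \<open>r\<close> add up to the total degree.\<close>
  have a_bound: "norm (a k z) \<le> M / r ^ k" if z: "\<forall>i. norm (z $ i) \<le> r" for k z
  proof -
    have zR: "z \<in> polydisc R" using z assms by (auto simp: polydisc_def intro: le_less_trans)
    have "norm ((deriv ^^ k) (\<lambda>w. f (vupd j z w)) 0) \<le> fact k * M / r ^ k"
    proof (rule Cauchy_inequality[OF _ _ assms(3)])
      show "(\<lambda>w. f (vupd j z w)) holomorphic_on ball 0 r"
        by (rule holomorphic_on_subset[OF hol[OF zR]]) (use assms in auto)
      show "continuous_on (cball 0 r) (\<lambda>w. f (vupd j z w))"
        by (rule continuous_on_subset[OF holomorphic_on_imp_continuous_on[OF hol[OF zR]]]) (use assms in auto)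
      show "norm (f (vupd j z w)) \<le> M" if "norm (0 - w) = r" for w
        by (rule M) (use that z in auto)
    qed
    then show ?thesis using assms(3) by (simp add: a_eq norm_divide field_simps)
  qed
  have a_dep: "a k z = a k z'" if z: "z \<in> polydisc R" "z' \<in> polydisc R" "\<forall>i\<in>S. z $ i = z' $ i" for k z z'
  proof -
    have "f (vupd j z w) = f (vupd j z' w)" if "w \<in> ball 0 R" for w
      by (rule dep) (use z that in \<open>auto intro: vupd_polydisc\<close>)
    then have "(deriv ^^ k) (\<lambda>w. f (vupd j z w)) 0 = (deriv ^^ k) (\<lambda>w. f (vupd j z' w)) 0"
      by (intro higher_deriv_transform_within_open[OF hol[OF z(1)] hol[OF z(2)]]) (use R in auto)
    then show ?thesis by (simp add: a_eq)
  qed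
  have "\<exists>F. (\<forall>\<alpha>. norm (F \<alpha>) \<le> (M / r ^ k) / r ^ (\<Sum>i\<in>UNIV. \<alpha> i)) \<and>
     (\<forall>z\<in>polydisc r. ((\<lambda>\<alpha>. F \<alpha> * (\<Prod>i\<in>UNIV. (z $ i) ^ \<alpha> i)) has_sum a k z) (supported S))" for k
    by (rule insert.IH[of "a k" "M / r ^ k"]) (fact a_hol a_bound a_dep)+
  then have "\<exists>F. \<forall>k. (\<forall>\<alpha>. norm (F k \<alpha>) \<le> (M / r ^ k) / r ^ (\<Sum>i\<in>UNIV. \<alpha> i)) \<and>
     (\<forall>z\<in>polydisc r. ((\<lambda>\<alpha>. F k \<alpha> * (\<Prod>i\<in>UNIV. (z $ i) ^ \<alpha> i)) has_sum a k z) (supported S))"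
    by (intro choice allI)
  then obtain F where F: "\<And>k \<alpha>. norm (F k \<alpha>) \<le> (M / r ^ k) / r ^ (\<Sum>i\<in>UNIV. \<alpha> i)"
    and F_sum: "\<And>k z. z \<in> polydisc r \<Longrightarrow>
      ((\<lambda>\<alpha>. F k \<alpha> * (\<Prod>i\<in>UNIV. (z $ i) ^ \<alpha> i)) has_sum a k z) (supported S)"
    by blast
  \<comment> \<open>The exponent of \<open>j\<close> selects the coefficient function, the remaining
    exponents the coefficient in its own series.\<close>
  define G where "G \<alpha> = F (\<alpha> j) (\<alpha>(j := 0))" for \<alpha>
  have sum_upd: "(\<Sum>i\<in>UNIV. \<alpha> i) = \<alpha> j + (\<Sum>i\<in>UNIV. (\<alpha>(j := 0)) i)" for \<alpha> :: "'n \<Rightarrow> nat"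
  proof -
    have "(\<Sum>i\<in>UNIV - {j}. \<alpha> i) = (\<Sum>i\<in>UNIV - {j}. (\<alpha>(j := 0)) i)" by (rule sum.cong) auto
    then show ?thesis using sum.remove[of UNIV j \<alpha>] sum.remove[of UNIV j "\<alpha>(j := 0)"] by simp
  qed
  have G: "norm (G \<alpha>) \<le> M / r ^ (\<Sum>i\<in>UNIV. \<alpha> i)" for \<alpha>
    using F[of "\<alpha> j" "\<alpha>(j := 0)"] by (subst sum_upd) (simp add: G_def power_add)
  have "((\<lambda>\<alpha>. G \<alpha> * (\<Prod>i\<in>UNIV. (z $ i) ^ \<alpha> i)) has_sum f z) (supported (insert j S))" (is "(?t has_sum _) _")
    if z: "z \<in> polydisc r" for z
  proof -
    have zR: "z \<in> polydisc R" using z polydisc_mono[of r R] assms by auto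
    \<comment> \<open>Summability comes before the value. Summing the unknown total \<open>L\<close>
      first over the exponents in \<open>S\<close> and then over \<open>k\<close> produces the
      one-variable Taylor series of the slice, whose sum is \<open>f z\<close>.\<close>
    have "(\<lambda>\<alpha>. norm (?t \<alpha>)) summable_on supported (insert j S)"
    proof (rule Infinite_Sum.abs_summable_on_comparison_test')
      have "(\<lambda>\<alpha>. \<Prod>i\<in>UNIV. (norm (z $ i) / r) ^ \<alpha> i) summable_on supported (insert j S)"
        by (rule summable_geometric_supported) (use z assms(3) insert.hyps(1) in \<open>auto simp: polydisc_def\<close>)
      then show "(\<lambda>\<alpha>. M * (\<Prod>i\<in>UNIV. (norm (z $ i) / r) ^ \<alpha> i)) summable_on supported (insert j S)"
        by (rule summable_on_cmult_right)
      fix \<alpha> :: "'n \<Rightarrow> nat"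
      have "norm (?t \<alpha>) \<le> M / r ^ (\<Sum>i\<in>UNIV. \<alpha> i) * (\<Prod>i\<in>UNIV. norm (z $ i) ^ \<alpha> i)"
        unfolding norm_mult prod_norm[symmetric] norm_power
        by (rule mult_right_mono[OF G]) (simp add: prod_nonneg)
      then show "norm (?t \<alpha>) \<le> M * (\<Prod>i\<in>UNIV. (norm (z $ i) / r) ^ \<alpha> i)"
        by (simp add: power_divide prod_dividef power_sum)
    qed
    then have "?t summable_on supported (insert j S)" by (rule abs_summable_summable)
    then obtain L where L: "(?t has_sum L) (supported (insert j S))" by (auto simp: summable_on_def)
    have "((\<lambda>x. ?t ((\<lambda>(k, \<beta>). \<beta>(j := k)) x)) has_sum L) (UNIV \<times> supported S)"
      using L by (subst has_sum_reindex_bij_betw[OF bij_betw_supported_insert[OF insert.hyps(2)]])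
    then have "((\<lambda>k. a k z * (z $ j) ^ k) has_sum L) UNIV"
    proof (rule has_sum_SigmaD)
      fix k :: nat
      have "((\<lambda>\<beta>. (F k \<beta> * (\<Prod>i\<in>UNIV. (z $ i) ^ \<beta> i)) * (z $ j) ^ k) has_sum a k z * (z $ j) ^ k) (supported S)"
        by (rule has_sum_cmult_left[OF F_sum[OF z]])
      then show "((\<lambda>\<beta>. ?t ((\<lambda>(k, \<beta>). \<beta>(j := k)) (k, \<beta>))) has_sum a k z * (z $ j) ^ k) (supported S)"
      proof (rule iffD1[OF has_sum_cong, rotated])
        fix \<beta> assume \<beta>: "\<beta> \<in> supported S"
        then have "\<beta> j = 0" using insert.hyps by auto
        then have "(\<beta>(j := k))(j := 0) = \<beta>" by auto
        then have "G (\<beta>(j := k)) = F k \<beta>" by (simp only: G_def fun_upd_same)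
        moreover have "(\<Prod>i\<in>UNIV. (z $ i) ^ (\<beta>(j := k)) i) = (z $ j) ^ k * (\<Prod>i\<in>UNIV. (z $ i) ^ \<beta> i)"
          by (rule prod_fun_upd_insert[OF insert.hyps(2) \<beta>]) simp
        ultimately show "(F k \<beta> * (\<Prod>i\<in>UNIV. (z $ i) ^ \<beta> i)) * (z $ j) ^ k = ?t ((\<lambda>(k, \<beta>). \<beta>(j := k)) (k, \<beta>))"
          by (simp only: prod.case mult_ac)
      qed
    qed
    then have "(\<lambda>k. a k z * (z $ j) ^ k) sums L" by (rule has_sum_imp_sums)
    moreover have "(\<lambda>k. a k z * (z $ j) ^ k) sums f z"
      using holomorphic_power_series[OF hol[OF zR], of "z $ j"] polydiscD[OF zR, of j] by (simp add: a_eq)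
    ultimately have "L = f z" by (rule sums_unique2)
    with L show ?thesis by (simp only:)
  qed
  with G show ?case by (intro exI[of _ G] conjI allI ballI)
qed

text \<open>At radius \<open>r / 2\<close> the terms are dominated by \<open>M\<close> times a
  product of geometric series of ratio 1/2.\<close>

lemma ps_convergentI:
  fixes F :: "'n::finite power_series"
  assumes "\<And>\<alpha>. norm (F \<alpha>) \<le> M / r ^ (\<Sum>i\<in>UNIV. \<alpha> i)" "r > 0"
  shows "ps_convergent F"
  unfolding ps_convergent_def
proof (intro exI[of _ "r / 2"] conjI)
  have "(\<lambda>\<alpha>::'n\<Rightarrow>nat. \<Prod>i\<in>UNIV. (1/2::real) ^ \<alpha> i) summable_on supported UNIV"
    by (rule summable_geometric_supported) auto
  then have "(\<lambda>\<alpha>::'n\<Rightarrow>nat. M * (\<Prod>i\<in>UNIV. (1/2::real) ^ \<alpha> i)) summable_on UNIV"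
    by (intro summable_on_cmult_right) simp
  moreover have "norm (norm (F \<alpha>) * (r/2) ^ (\<Sum>i\<in>UNIV. \<alpha> i)) \<le> M * (\<Prod>i\<in>UNIV. (1/2::real) ^ \<alpha> i)" for \<alpha>
  proof -
    have "norm (F \<alpha>) * (r/2) ^ (\<Sum>i\<in>UNIV. \<alpha> i) \<le> M / r ^ (\<Sum>i\<in>UNIV. \<alpha> i) * (r/2) ^ (\<Sum>i\<in>UNIV. \<alpha> i)"
      by (rule mult_right_mono[OF assms(1)]) (use assms(2) in simp)
    also have "\<dots> = M * (1/2) ^ (\<Sum>i\<in>UNIV. \<alpha> i)" using assms(2) by (simp add: power_divide)
    also have "\<dots> = M * (\<Prod>i\<in>UNIV. (1/2) ^ \<alpha> i)" by (simp only: power_sum)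
    finally have "norm (F \<alpha>) * (r/2) ^ (\<Sum>i\<in>UNIV. \<alpha> i) \<le> M * (\<Prod>i\<in>UNIV. (1/2) ^ \<alpha> i)" .
    moreover have "0 \<le> norm (F \<alpha>) * (r/2) ^ (\<Sum>i\<in>UNIV. \<alpha> i)" using assms(2) by simp
    ultimately show ?thesis by (simp only: real_norm_def abs_of_nonneg)
  qed
  ultimately have "(\<lambda>\<alpha>. norm (norm (F \<alpha>) * (r/2) ^ (\<Sum>i\<in>UNIV. \<alpha> i))) summable_on UNIV"
    by - (erule Infinite_Sum.abs_summable_on_comparison_test', blast)
  then show "(\<lambda>\<alpha>. norm (F \<alpha>) * (r/2) ^ (\<Sum>i\<in>UNIV. \<alpha> i)) summable_on UNIV"
    using assms(2) by simp
qed (use assms in auto)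

lemma separately_holomorphic_expansion:
  fixes f :: "complex^'n \<Rightarrow> complex"
  assumes "separately_holomorphic R f" "0 < r" "r < R"
  obtains F where "ps_convergent F" "\<And>z. z \<in> polydisc r \<Longrightarrow> f z = ps_eval F (\<lambda>i. z $ i)"
proof -
  obtain M where M: "\<And>z. \<forall>i. norm (z $ i) \<le> r \<Longrightarrow> norm (f z) \<le> M"
    using separately_holomorphic_bounded[OF assms(1,3)] by metis
  have "\<exists>F. (\<forall>\<alpha>. norm (F \<alpha>) \<le> M / r ^ (\<Sum>i\<in>UNIV. \<alpha> i)) \<and>
     (\<forall>z\<in>polydisc r. ((\<lambda>\<alpha>. F \<alpha> * (\<Prod>i\<in>UNIV. (z $ i) ^ \<alpha> i)) has_sum f z) (supported UNIV))"
    by (rule separately_holomorphic_expansion_supported[OF _ assms M]) 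
       (auto simp: vec_eq_iff intro!: arg_cong[of _ _ f])
  then obtain F where F: "\<And>\<alpha>. norm (F \<alpha>) \<le> M / r ^ (\<Sum>i\<in>UNIV. \<alpha> i)"
    "\<And>z. z \<in> polydisc r \<Longrightarrow> ((\<lambda>\<alpha>. F \<alpha> * (\<Prod>i\<in>UNIV. (z $ i) ^ \<alpha> i)) has_sum f z) UNIV"
    by auto
  have "f z = ps_eval F (\<lambda>i. z $ i)" if "z \<in> polydisc r" for z
    using infsumI[OF F(2)[OF that]] by (simp add: ps_eval_def)
  then show thesis using that ps_convergentI[OF F(1) assms(2)] by blast
qed

section \<open>Volume of Lipschitz images\<close>

text \<open>The norm is at most the sum of the coordinates' absolute values, so a cube of side
  \<open>l\<close> lies within \<open>DIM('a) * l\<close> of its corner \<open>u\<close>, and its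
  image within \<open>d\<close> of \<open>f u\<close> in every coordinate. The open box on the right
  suits nonoverlapping cubes, whose interiors are disjoint.\<close>

lemma cube_image_emeasure:
  fixes f :: "'a::euclidean_space \<Rightarrow> 'a"
  assumes lip: "\<And>x y. x \<in> cbox u v \<Longrightarrow> y \<in> cbox u v \<Longrightarrow> norm (f x - f y) \<le> L * norm (x - y)"
    and "L \<ge> 0" "l \<ge> 0" and side: "\<And>i. i \<in> Basis \<Longrightarrow> v \<bullet> i - u \<bullet> i = l"
  shows "\<exists>B \<in> sets lborel. f ` cbox u v \<subseteq> B \<and>
    emeasure lborel B = ennreal ((2 * L * DIM('a)) ^ DIM('a)) * emeasure lborel (box u v)"
proof -
  define d where "d = L * (DIM('a) * l)"
  have d: "d \<ge> 0" using assms by (simp add: d_def)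
  let ?B = "cbox (f u - d *\<^sub>R One) (f u + d *\<^sub>R One)"
  have u: "u \<in> cbox u v" using side \<open>l \<ge> 0\<close> by (auto simp: mem_box) (metis diff_ge_0_iff_ge)
  have "f x \<in> ?B" if x: "x \<in> cbox u v" for x
  proof -
    have "norm (x - u) \<le> (\<Sum>i\<in>Basis. \<bar>(x - u) \<bullet> i\<bar>)" by (rule norm_le_l1)
    also have "\<dots> \<le> (\<Sum>i\<in>(Basis::'a set). l)"
      using x side by (intro sum_mono) (force simp: mem_box inner_diff_left)
    finally have "norm (f x - f u) \<le> d"
      using lip[OF x u] mult_left_mono[OF _ \<open>L \<ge> 0\<close>, of "norm (x - u)" "DIM('a) * l"] by (simp add: d_def)
    then have "\<bar>(f x - f u) \<bullet> i\<bar> \<le> d" if "i \<in> Basis" for i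
      using Basis_le_norm[OF that, of "f x - f u"] by linarith
    then show ?thesis by (force simp: mem_box inner_diff_left inner_add_left abs_le_iff)
  qed
  moreover have "emeasure lborel ?B = ennreal ((2 * d) ^ DIM('a))"
    using d by (subst emeasure_lborel_cbox) (auto simp: inner_diff_left inner_add_left algebra_simps)
  moreover have "emeasure lborel (box u v) = ennreal (l ^ DIM('a))"
    using side \<open>l \<ge> 0\<close> by (subst emeasure_lborel_box) (auto simp: inner_diff_left, metis diff_ge_0_iff_ge)
  ultimately show ?thesis using assms(2,3)
    by (intro bexI[of _ ?B]) (auto simp: d_def ennreal_mult[symmetric] power_mult_distrib[symmetric] mult_ac)
qed

text \<open>\<open>S\<close> is a countable union of nonoverlapping cubes, and a cube of side \<open>l\<close> is mapped into a cube of side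
  \<open>2 L DIM l\<close>.\<close>

lemma Lipschitz_image_emeasure:
  fixes f :: "'a::euclidean_space \<Rightarrow> 'a"
  assumes "open S" "bounded S" "L \<ge> 0"
    and lip: "\<And>x y. x \<in> S \<Longrightarrow> y \<in> S \<Longrightarrow> norm (f x - f y) \<le> L * norm (x - y)"
    and "A \<subseteq> f ` S"
  shows "emeasure lborel A \<le> ennreal ((2 * L * DIM('a)) ^ DIM('a)) * emeasure lborel S"
proof -
  let ?C = "ennreal ((2 * L * DIM('a)) ^ DIM('a))"
  obtain c where c: "c > 0" "S \<subseteq> cbox (- (c *\<^sub>R One)) (c *\<^sub>R One)"
  proof -
    obtain e where e: "\<And>x. x \<in> S \<Longrightarrow> norm x \<le> e" using \<open>bounded S\<close> by (auto simp: bounded_iff)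
    have "x \<in> cbox (- (max 1 e *\<^sub>R One)) (max 1 e *\<^sub>R One)" if "x \<in> S" for x
    proof -
      have "\<bar>x \<bullet> i\<bar> \<le> max 1 e" if "i \<in> Basis" for i
        using Basis_le_norm[OF that, of x] e[OF \<open>x \<in> S\<close>] by linarith
      then show ?thesis by (force simp: mem_box abs_le_iff)
    qed
    then show thesis by (intro that[of "max 1 e"]) auto
  qed
  \<comment> \<open>This gauge makes the covering lemma return cubes inside \<open>S\<close>: each
    cube \<open>K\<close> has a tag \<open>x\<close> in \<open>S\<close> with
    \<open>K \<subseteq> g x\<close>, and there \<open>g x\<close> is \<open>S\<close>
    itself.\<close>
  define g where "g x = (if x \<in> S then S else UNIV)" for x
  have g: "gauge g" using \<open>open S\<close> by (auto simp: gauge_def g_def)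
  have ne: "box (- (c *\<^sub>R One)) (c *\<^sub>R (One::'a)) \<noteq> {}" using c by (auto simp: box_ne_empty)
  obtain D where D: "countable D"
    "\<And>K. K \<in> D \<Longrightarrow> interior K \<noteq> {} \<and> (\<exists>c d. K = cbox c d)"
    "pairwise (\<lambda>A B. interior A \<inter> interior B = {}) D"
    "\<And>K. K \<in> D \<Longrightarrow> \<exists>x \<in> S \<inter> K. K \<subseteq> g x"
    "\<And>u v. cbox u v \<in> D \<Longrightarrow> \<exists>n. \<forall>i \<in> Basis. v \<bullet> i - u \<bullet> i = ((c *\<^sub>R One) \<bullet> i - (- (c *\<^sub>R One)) \<bullet> i) / 2^n"
    "S \<subseteq> \<Union>D"
    by (rule covering_lemma[OF c(2) ne g]) blast
  have sub: "K \<subseteq> S" if "K \<in> D" for K using D(4)[OF that] by (auto simp: g_def)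
  \<comment> \<open>The countable family \<open>D\<close> may be finite, so its enumeration by the
    naturals is padded with empty sets.\<close>
  define K where "K m = (if m \<in> to_nat_on D ` D then from_nat_into D m else {})" for m
  have K: "K m = {} \<or> K m \<in> D" for m
    unfolding K_def by (auto intro: from_nat_into)
  have DK: "D \<subseteq> range K"
  proof
    fix Q assume "Q \<in> D"
    then have "Q = K (to_nat_on D Q)" using D(1) by (simp add: K_def)
    then show "Q \<in> range K" by blast
  qed
  have disj: "disjoint_family (\<lambda>m. interior (K m))"
    unfolding disjoint_family_on_def
  proof (intro ballI impI)
    fix m n :: nat assume "m \<noteq> n"
    then have "K m \<noteq> K n \<or> K m = {}" using D(1) by (auto simp: K_def)
    then show "interior (K m) \<inter> interior (K n) = {}"
      using K[of m] K[of n] D(3) unfolding pairwise_def by fastforce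
  qed
  have "\<exists>B \<in> sets lborel. f ` K m \<subseteq> B \<and> emeasure lborel B = ?C * emeasure lborel (interior (K m))" for m
  proof (cases "K m = {}")
    case True
    then show ?thesis by (intro bexI[of _ "{}"]) auto
  next
    case False
    then have m: "K m \<in> D" using K by blast
    obtain u v where uv: "K m = cbox u v" using D(2)[OF m] by blast
    obtain n :: nat where n: "\<forall>i \<in> Basis. v \<bullet> i - u \<bullet> i = (2 * c) / 2^n"
      using D(5)[of u v] m uv by auto
    have "norm (f x - f y) \<le> L * norm (x - y)" if "x \<in> cbox u v" "y \<in> cbox u v" for x y
      by (rule lip) (use sub[OF m] uv that in auto)
    then show ?thesis unfolding uv interior_cbox
      by (rule cube_image_emeasure[OF _ \<open>L \<ge> 0\<close>, where l = "(2 * c) / 2^n"]) (use n c in auto)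
  qed
  then have "\<exists>B. \<forall>m. B m \<in> sets lborel \<and> f ` K m \<subseteq> B m \<and>
      emeasure lborel (B m) = ?C * emeasure lborel (interior (K m))"
    unfolding Bex_def by (intro choice allI)
  then obtain B where B: "\<And>m. B m \<in> sets lborel" "\<And>m. f ` K m \<subseteq> B m"
    "\<And>m. emeasure lborel (B m) = ?C * emeasure lborel (interior (K m))"
    by blast
  have "A \<subseteq> (\<Union>m. B m)"
  proof
    fix a assume "a \<in> A"
    then obtain x where x: "x \<in> S" "a = f x" using assms(5) by blast
    then obtain m where "x \<in> K m" using D(6) DK by blast
    with x B(2)[of m] show "a \<in> (\<Union>m. B m)" by blast
  qed
  then have "emeasure lborel A \<le> emeasure lborel (\<Union>m. B m)"
    by (rule emeasure_mono) (use B(1) in auto)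
  also have "\<dots> \<le> (\<Sum>m. emeasure lborel (B m))"
    by (rule emeasure_subadditive_countably) (use B(1) in auto)
  also have "\<dots> = ?C * (\<Sum>m. emeasure lborel (interior (K m)))"
    by (simp add: B(3) ennreal_suminf_cmult)
  also have "(\<Sum>m. emeasure lborel (interior (K m))) = emeasure lborel (\<Union>m. interior (K m))"
    by (rule suminf_emeasure[OF _ disj]) auto
  also have "emeasure lborel (\<Union>m. interior (K m)) \<le> emeasure lborel S"
  proof (rule emeasure_mono)
    have "interior (K m) \<subseteq> S" for m using sub[of "K m"] K[of m] interior_subset[of "K m"] by auto
    then show "(\<Union>m. interior (K m)) \<subseteq> S" by blast
  qed (use \<open>open S\<close> in simp)
  finally show ?thesis by (simp add: mult_left_mono)
qed

text \<open>A lower bound suffices, so a box is inscribed: real and imaginary parts below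
  \<open>h i / 2\<close> in absolute value force \<open>norm (x $ i) < h i\<close>. Two real sides
  of length \<open>h i\<close> for each \<open>i\<close> give the square.\<close>

lemma emeasure_anisotropic_polydisc_ge:
  fixes h :: "'n::finite \<Rightarrow> real"
  assumes "\<And>i. h i > 0"
  shows "emeasure lborel {x :: complex^'n. \<forall>i. norm (x $ i) < h i} \<ge> ennreal (\<Prod>i\<in>UNIV. (h i)\<^sup>2)"
proof -
  define u :: "complex^'n" where "u = (\<chi> i. Complex (h i / 2) (h i / 2))"
  have B: "(Basis :: (complex^'n) set) = (\<lambda>(i, b). axis i b) ` (UNIV \<times> Basis)"
    by (auto simp: Basis_vec_def)
  have inj: "inj_on (\<lambda>(i, b). axis i b) (UNIV \<times> (Basis :: complex set) :: ('n \<times> complex) set)"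
    by (auto simp: inj_on_def axis_eq_axis)
  have comp: "u \<bullet> axis i b = h i / 2" if "b \<in> Basis" for i b
    using that by (auto simp: u_def inner_axis Basis_complex_def inner_complex_def)
  have comp2: "(u - (-u)) \<bullet> axis i b = h i" if "b \<in> Basis" for i b
    unfolding inner_diff_left inner_minus_left comp[OF that] by simp
  have pos: "- u \<bullet> b \<le> u \<bullet> b" if "b \<in> Basis" for b
  proof -
    have "\<exists>i. \<exists>b'\<in>Basis. b = axis i b'" using that by (auto simp: Basis_vec_def)
    then obtain i b' where "b = axis i b'" "b' \<in> Basis" by blast
    then show ?thesis using comp[of b' i] assms[of i] by simp
  qed
  have "emeasure lborel (box (-u) u) = ennreal (\<Prod>b\<in>Basis. (u - (-u)) \<bullet> b)"
    using pos by (intro emeasure_lborel_box) auto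
  also have "(\<Prod>b\<in>Basis. (u - (-u)) \<bullet> b) = (\<Prod>(i, b)\<in>UNIV \<times> (Basis :: complex set). h i)"
    unfolding B prod.reindex[OF inj] by (rule prod.cong) (auto simp only: o_def split_paired_all prod.case comp2 mem_Sigma_iff)
  also have "\<dots> = (\<Prod>i\<in>UNIV. (h i)\<^sup>2)"
    by (subst prod.cartesian_product[symmetric]) simp
  finally have "emeasure lborel (box (-u) u) = ennreal (\<Prod>i\<in>UNIV. (h i)\<^sup>2)" .
  moreover have "box (-u) u \<subseteq> {x. \<forall>i. norm (x $ i) < h i}"
  proof (intro subsetI CollectI allI)
    fix x i assume "x \<in> box (-u) u"
    then have "\<bar>x \<bullet> axis i b\<bar> < h i / 2" if "b \<in> Basis" for b
    proof -
      have "axis i b \<in> (Basis :: (complex^'n) set)" using that by (auto simp: Basis_vec_def)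
      then have "- (u \<bullet> axis i b) < x \<bullet> axis i b" "x \<bullet> axis i b < u \<bullet> axis i b"
        using \<open>x \<in> box (-u) u\<close> by (auto simp: mem_box)
      then show ?thesis using comp[OF that, of i] by (simp add: abs_less_iff)
    qed
    from this[of 1] this[of \<i>] have "\<bar>Re (x $ i)\<bar> < h i / 2" "\<bar>Im (x $ i)\<bar> < h i / 2"
      by (auto simp: Basis_complex_def inner_axis)
    then show "norm (x $ i) < h i" using cmod_le[of "x $ i"] by linarith
  qed
  moreover have "{x :: complex^'n. \<forall>i. norm (x $ i) < h i} \<in> sets lborel"
  proof -
    have "{x :: complex^'n. \<forall>i. norm (x $ i) < h i} = (\<Inter>i. {x. norm (x $ i) < h i})" by auto
    moreover have "open {x :: complex^'n. norm (x $ i) < h i}" for i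
      by (intro open_Collect_less continuous_intros)
    ultimately show ?thesis by (auto intro!: borel_open open_INT)
  qed
  ultimately show ?thesis by (metis emeasure_mono)
qed

section \<open>Complex differentiability and the holomorphic inverse function theorem\<close>

text \<open>Complex differentiability at a single point, in the form that a chart provides;
  continuity of the derivative is recovered later from differentiability on a polydisc.\<close>

definition holo_at :: "(complex^'n \<Rightarrow> complex) \<Rightarrow> complex^'n \<Rightarrow> bool" where
  "holo_at f z \<longleftrightarrow> (\<exists>D. (f has_derivative D) (at z) \<and> (\<forall>c v. D (c *s v) = c * D v))"

definition holo_map_at :: "(complex^'n \<Rightarrow> complex^'m) \<Rightarrow> complex^'n \<Rightarrow> bool" where
  "holo_map_at f z \<longleftrightarrow> (\<exists>D. (f has_derivative D) (at z) \<and> (\<forall>c v. D (c *s v) = c *s D v))"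

lemma holo_at_const [simp]: "holo_at (\<lambda>_. c) z"
  unfolding holo_at_def by (intro exI[of _ "\<lambda>_. 0"]) auto

lemma holo_at_nth [simp]: "holo_at (\<lambda>z. z $ i) z"
  unfolding holo_at_def
  by (intro exI[of _ "\<lambda>v. v $ i"]) (auto intro: bounded_linear_imp_has_derivative bounded_linear_vec_nth)

lemma holo_atI: "(f has_derivative D) (at z) \<Longrightarrow> (\<And>c v. D (c *s v) = c * D v) \<Longrightarrow> holo_at f z"
  unfolding holo_at_def by blast

lemma holo_atE:
  assumes "holo_at f z"
  obtains D where "(f has_derivative D) (at z)" "\<And>c v. D (c *s v) = c * D v"
  using assms unfolding holo_at_def by blast

lemma holo_map_atI: "(f has_derivative D) (at z) \<Longrightarrow> (\<And>c v. D (c *s v) = c *s D v) \<Longrightarrow> holo_map_at f z"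
  unfolding holo_map_at_def by blast

lemma holo_map_atE:
  assumes "holo_map_at f z"
  obtains D where "(f has_derivative D) (at z)" "\<And>c v. D (c *s v) = c *s D v"
  using assms unfolding holo_map_at_def by blast

lemma holo_at_add:
  assumes "holo_at f z" "holo_at g z"
  shows "holo_at (\<lambda>z. f z + g z) z"
proof -
  obtain D E where D: "(f has_derivative D) (at z)" "\<And>c v. D (c *s v) = c * D v"
    and E: "(g has_derivative E) (at z)" "\<And>c v. E (c *s v) = c * E v"
    using assms by (metis holo_atE)
  show ?thesis by (rule holo_atI[OF has_derivative_add[OF D(1) E(1)]]) (simp add: D E algebra_simps)
qed

lemma holo_at_mult:
  assumes "holo_at f z" "holo_at g z"
  shows "holo_at (\<lambda>z. f z * g z) z"
proof -
  obtain D E where D: "(f has_derivative D) (at z)" "\<And>c v. D (c *s v) = c * D v"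
    and E: "(g has_derivative E) (at z)" "\<And>c v. E (c *s v) = c * E v"
    using assms by (metis holo_atE)
  show ?thesis by (rule holo_atI[OF has_derivative_mult[OF D(1) E(1)]]) (simp add: D E algebra_simps)
qed

lemma holo_at_divide:
  assumes "holo_at f z" "holo_at g z" "g z \<noteq> 0"
  shows "holo_at (\<lambda>z. f z / g z) z"
proof -
  obtain D E where D: "(f has_derivative D) (at z)" "\<And>c v. D (c *s v) = c * D v"
    and E: "(g has_derivative E) (at z)" "\<And>c v. E (c *s v) = c * E v"
    using assms by (metis holo_atE)
  show ?thesis
    by (rule holo_atI[OF has_derivative_divide'[OF D(1) E(1) assms(3)]]) (simp add: D E algebra_simps)
qed

lemma holo_at_cong_open: "holo_at f z \<Longrightarrow> open W \<Longrightarrow> z \<in> W \<Longrightarrow> (\<And>x. x \<in> W \<Longrightarrow> f x = g x) \<Longrightarrow> holo_at g z"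
  unfolding holo_at_def using has_derivative_transform_within_open by blast

lemma holo_at_compose:
  assumes "holo_at g (f z)" "holo_map_at f z"
  shows "holo_at (\<lambda>z. g (f z)) z"
proof -
  obtain D E where D: "(g has_derivative D) (at (f z))" "\<And>c v. D (c *s v) = c * D v"
    and E: "(f has_derivative E) (at z)" "\<And>c v. E (c *s v) = c *s E v"
    using assms by (metis holo_atE holo_map_atE)
  show ?thesis by (rule holo_atI[OF has_derivative_compose[OF E(1) D(1)]]) (simp add: D E)
qed

lemma holo_map_at_compose:
  assumes "holo_map_at g (f z)" "holo_map_at f z"
  shows "holo_map_at (\<lambda>z. g (f z)) z"
proof -
  obtain D E where D: "(g has_derivative D) (at (f z))" "\<And>c v. D (c *s v) = c *s D v"
    and E: "(f has_derivative E) (at z)" "\<And>c v. E (c *s v) = c *s E v"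
    using assms by (metis holo_map_atE)
  show ?thesis by (rule holo_map_atI[OF has_derivative_compose[OF E(1) D(1)]]) (simp add: D E)
qed

lemma holo_map_at_translate: "holo_map_at (\<lambda>z. a + z) z"
  by (rule holo_map_atI[where D = "\<lambda>v. v"]) (auto intro!: derivative_eq_intros)

lemma holo_at_imp_isCont: "holo_at f z \<Longrightarrow> isCont f z"
  unfolding holo_at_def using has_derivative_continuous by blast

lemma holo_at_poly_fun: "p \<in> poly_fun \<Longrightarrow> holo_at p z"
proof (induction rule: poly_fun.induct)
  case (add p q)
  show ?case by (rule holo_at_add[OF add.IH])
next
  case (mult p q)
  show ?case by (rule holo_at_mult[OF mult.IH])
qed simp_all

lemma linear_axis: "linear (axis j :: complex \<Rightarrow> complex^'n)"
  by (rule linearI) (auto simp: vec_eq_iff axis_def)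

lemma vupd_eq_axis: "vupd j z w = vupd j z 0 + axis j w"
  by (simp add: vec_eq_iff axis_def)

lemma holo_at_has_field_derivative:
  fixes f :: "complex^'n \<Rightarrow> complex"
  assumes D: "(f has_derivative D) (at (vupd j z w))" "\<And>c v. D (c *s v) = c * D v"
  shows "((\<lambda>w. f (vupd j z w)) has_field_derivative D (axis j 1)) (at w)"
proof -
  have "bounded_linear (axis j :: complex \<Rightarrow> complex^'n)"
    using linear_axis linear_conv_bounded_linear by blast
  then have "(axis j has_derivative (axis j :: complex \<Rightarrow> complex^'n)) (at w)"
    by (rule bounded_linear_imp_has_derivative)
  from has_derivative_add[OF has_derivative_const[of "vupd j z 0"] this]
  have "((\<lambda>w. vupd j z w) has_derivative axis j) (at w)"
    by (simp only: vupd_eq_axis[symmetric] add_0)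
  from has_derivative_compose[OF this D(1)]
  have "((\<lambda>w. f (vupd j z w)) has_derivative (\<lambda>h. D (axis j h))) (at w)" .
  moreover have "D (axis j h) = D (axis j 1) * h" for h
  proof -
    have "axis j h = h *s (axis j 1 :: complex^'n)" by (simp add: vec_eq_iff axis_def)
    then have "D (axis j h) = D (h *s axis j 1)" by (rule arg_cong)
    also have "\<dots> = h * D (axis j 1)" by (rule D(2))
    finally show ?thesis by (rule trans[OF _ mult.commute])
  qed
  then have "(\<lambda>h. D (axis j h)) = (*) (D (axis j 1))" by (intro ext)
  ultimately show ?thesis unfolding has_field_derivative_def by simp
qed

lemma separately_holomorphicI:
  fixes f :: "complex^'n \<Rightarrow> complex"
  assumes "\<And>z. z \<in> polydisc R \<Longrightarrow> holo_at f z"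
  shows "separately_holomorphic R f"
  unfolding separately_holomorphic_def
proof (intro conjI ballI allI)
  show "continuous_on (polydisc R) f"
    by (intro continuous_at_imp_continuous_on ballI holo_at_imp_isCont assms)
next
  fix z :: "complex^'n" and j assume z: "z \<in> polydisc R"
  have "(\<lambda>w. f (vupd j z w)) field_differentiable at w" if "w \<in> ball 0 R" for w
  proof -
    have "holo_at f (vupd j z w)" using that by (intro assms vupd_polydisc[OF z]) simp
    then show ?thesis unfolding holo_at_def field_differentiable_def using holo_at_has_field_derivative by blast
  qed
  then show "(\<lambda>w. f (vupd j z w)) holomorphic_on ball 0 R"
    by (simp add: holomorphic_on_def field_differentiable_at_within)
qed

text \<open>Writes the full derivative through one-variable derivatives of slices. Since those are
  separately holomorphic in the base point, the derivative depends continuously on it.\<close>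

lemma complex_derivative_eq_partial_deriv:
  fixes f :: "complex^'n \<Rightarrow> complex"
  assumes D: "(f has_derivative D) (at z)" "\<And>c v. D (c *s v) = c * D v"
  shows "D v = (\<Sum>j\<in>UNIV. v $ j * partial_deriv j f z)"
proof -
  have "D (axis j 1) = partial_deriv j f z" for j
    using holo_at_has_field_derivative[of f D j z "z $ j"] D
    unfolding partial_deriv_def by (simp add: DERIV_imp_deriv)
  note ax = this
  have lin: "linear D" using D(1) has_derivative_linear by blast
  have "D v = D (\<Sum>j\<in>UNIV. v $ j *s axis j 1)" by (simp only: basis_expansion)
  also have "\<dots> = (\<Sum>j\<in>UNIV. D (v $ j *s axis j 1))" by (rule linear_sum[OF lin])
  also have "\<dots> = (\<Sum>j\<in>UNIV. v $ j * partial_deriv j f z)"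
  proof (rule sum.cong[OF refl])
    fix j :: 'n
    have "D (v $ j *s axis j 1) = v $ j * D (axis j 1)" by (rule D(2))
    then show "D (v $ j *s axis j 1) = v $ j * partial_deriv j f z" unfolding ax .
  qed
  finally show ?thesis .
qed

lemma has_derivative_vec_componentwise:
  fixes f :: "'a::real_normed_vector \<Rightarrow> complex^'n"
  assumes "\<And>i. ((\<lambda>z. f z $ i) has_derivative (\<lambda>v. D v $ i)) (at a)"
  shows "(f has_derivative D) (at a)"
proof (rule has_derivative_componentwise_within[THEN iffD2], rule ballI)
  fix b :: "complex^'n" assume "b \<in> Basis"
  then obtain i c where b: "b = axis i c" by (auto simp: Basis_vec_def)
  show "((\<lambda>x. f x \<bullet> b) has_derivative (\<lambda>x. D x \<bullet> b)) (at a)"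
    unfolding b inner_axis by (rule has_derivative_inner_left[OF assms])
qed

text \<open>The real inverse function theorem applies because the matrix \<open>A\<close> of partial
  derivatives is continuous by the Cauchy estimates. The inverse is again holomorphic, since its
  derivative inverts a complex-linear bijection.\<close>

lemma holomorphic_local_inverse:
  fixes \<tau> :: "complex^'n \<Rightarrow> complex^'n"
  assumes R: "R > 0" and hol: "\<And>z i. z \<in> polydisc R \<Longrightarrow> holo_at (\<lambda>z. \<tau> z $ i) z"
    and D: "(\<tau> has_derivative D) (at 0)" "\<And>v. D v = 0 \<Longrightarrow> v = 0"
  obtains U V g L where "open U" "0 \<in> U" "U \<subseteq> polydisc R" "bounded U" "open V" "\<tau> 0 \<in> V"
    "homeomorphism U V \<tau> g" "\<And>y. y \<in> V \<Longrightarrow> holo_map_at g y"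
    "L \<ge> 0" "\<And>x y. x \<in> U \<Longrightarrow> y \<in> U \<Longrightarrow> norm (\<tau> x - \<tau> y) \<le> L * norm (x - y)"
proof -
  have sep: "separately_holomorphic R (\<lambda>z. \<tau> z $ i)" for i
    using hol by (rule separately_holomorphicI)
  define A where "A z v = (\<chi> i. \<Sum>j\<in>UNIV. v $ j * partial_deriv j (\<lambda>z. \<tau> z $ i) z)" for z v
  have A_scale: "A z (c *s v) = c *s A z v" for z c v
    by (simp add: A_def vec_eq_iff sum_distrib_left mult_ac)
  have der: "(\<tau> has_derivative A z) (at z)" if z: "z \<in> polydisc R" for z
  proof (rule has_derivative_vec_componentwise)
    fix i
    obtain E where E: "((\<lambda>z. \<tau> z $ i) has_derivative E) (at z)" "\<And>c v. E (c *s v) = c * E v"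
      using hol[OF z, of i] unfolding holo_at_def by blast
    have "E = (\<lambda>v. A z v $ i)" using complex_derivative_eq_partial_deriv[OF E] by (auto simp: A_def)
    with E(1) show "((\<lambda>z. \<tau> z $ i) has_derivative (\<lambda>v. A z v $ i)) (at z)" by simp
  qed
  define f' where "f' z = Blinfun (A z)" for z
  have f': "blinfun_apply (f' z) = A z" if "z \<in> polydisc R" for z
    unfolding f'_def using has_derivative_bounded_linear[OF der[OF that]] by (rule bounded_linear_Blinfun_apply)
  have cont: "continuous_on (polydisc R) f'"
  proof (rule continuous_on_blinfun_componentwise)
    fix b :: "complex^'n"
    have "continuous_on (polydisc R) (\<lambda>z. A z b)"
      unfolding A_def using separately_holomorphic_partial_deriv[OF sep]
      by (intro continuous_on_vec_lambda continuous_intros) (auto simp: separately_holomorphic_def)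
    then show "continuous_on (polydisc R) (\<lambda>z. blinfun_apply (f' z) b)"
      by (rule continuous_on_eq) (simp add: f')
  qed
  have 0: "(0 :: complex^'n) \<in> polydisc R" using R by (simp add: polydisc_def)
  have A0: "A 0 = D" using der[OF 0] D(1) has_derivative_unique by blast
  have "linear (A 0)" using der[OF 0] has_derivative_linear by blast
  moreover have "inj (A 0)" using \<open>linear (A 0)\<close> D(2) A0 linear_injective_0 by blast
  ultimately obtain h where h: "linear h" "h \<circ> A 0 = id" using linear_injective_left_inverse by blast
  \<comment> \<open>The inverse function theorem asks for a left inverse of the derivative, which
    injectivity of \<open>D\<close> supplies.\<close>
  have "Blinfun h o\<^sub>L f' 0 = id_blinfun"
  proof (rule blinfun_eqI)
    fix v
    have "bounded_linear h" using h(1) linear_conv_bounded_linear by blast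
    then show "blinfun_apply (Blinfun h o\<^sub>L f' 0) v = blinfun_apply id_blinfun v"
      using h(2) f'[OF 0] by (simp add: bounded_linear_Blinfun_apply fun_eq_iff)
  qed
  note inv = this
  obtain d where d: "d > 0" "ball 0 d \<subseteq> (polydisc R :: (complex^'n) set)" using open_polydisc 0 open_contains_ball by blast
  obtain e where e: "e > 0" "\<And>z. z \<in> polydisc R \<Longrightarrow> dist z 0 < e \<Longrightarrow> dist (f' z) (f' 0) < 1"
    using continuous_onE[OF cont 0, of 1] by (metis zero_less_one continuous_on_iff cont 0)
  define \<rho> where "\<rho> = min d e"
  have \<rho>: "\<rho> > 0" "ball 0 \<rho> \<subseteq> (polydisc R :: (complex^'n) set)" 
  proof -
    show "\<rho> > 0" using d e by (simp add: \<rho>_def)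
    show "ball 0 \<rho> \<subseteq> (polydisc R :: (complex^'n) set)" by (rule subset_trans[OF _ d(2)]) (simp add: \<rho>_def subset_ball)
  qed
  \<comment> \<open>On the ball of radius \<open>\<rho>\<close> the derivative is within distance 1
    of \<open>f' 0\<close>, so \<open>L\<close> bounds its operator norm there; the mean value
    inequality on the convex ball makes \<open>L\<close> a Lipschitz constant.\<close>
  define L where "L = norm (f' 0) + 1"
  have bound: "onorm (A z) \<le> L" if "z \<in> ball 0 \<rho>" for z
  proof -
    have "dist (f' z) (f' 0) < 1" using that \<rho>(2) by (intro e(2)) (auto simp: \<rho>_def dist_norm)
    then have "norm (f' z) \<le> L" unfolding L_def dist_norm using norm_triangle_sub[of "f' z" "f' 0"] by linarith
    then show ?thesis using f' \<rho>(2) that by (simp add: norm_blinfun.rep_eq subset_iff)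
  qed
  have lip: "norm (\<tau> x - \<tau> y) \<le> L * norm (x - y)" if "x \<in> ball 0 \<rho>" "y \<in> ball 0 \<rho>" for x y
  proof (rule differentiable_bound[OF convex_ball _ bound that])
    fix x :: "complex^'n" assume "x \<in> ball 0 \<rho>"
    then have "x \<in> polydisc R" using \<rho>(2) by blast
    then show "(\<tau> has_derivative A x) (at x within ball 0 \<rho>)" by (rule has_derivative_at_withinI[OF der])
  qed
  have der': "(\<tau> has_derivative blinfun_apply (f' x)) (at x)" if "x \<in> ball 0 \<rho>" for x
  proof -
    have "x \<in> polydisc R" using \<rho>(2) that by blast
    then show ?thesis using der f' by simp
  qed
  have cont': "continuous_on (ball 0 \<rho>) f'" using cont \<rho>(2) continuous_on_subset by blast
  have mem: "0 \<in> ball (0 :: complex^'n) \<rho>" using \<rho> by simp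
  obtain U V g g' where inv: "open U" "U \<subseteq> ball 0 \<rho>" "0 \<in> U" "open V" "\<tau> 0 \<in> V" "homeomorphism U V \<tau> g"
    and inv': "\<forall>y\<in>V. (g has_derivative (g' y)) (at y) \<and>
      g' y = Hilbert_Choice.inv (blinfun_apply (f' (g y))) \<and> bij (blinfun_apply (f' (g y)))"
    by (rule inverse_function_theorem[OF open_ball der' cont' mem inv]) blast+
  have "holo_map_at g y" if y: "y \<in> V" for y
  proof -
    have gy: "g y \<in> polydisc R"
      using inv(2,6) \<rho>(2) y by (auto simp: homeomorphism_def)
    have g': "g' y = Hilbert_Choice.inv (A (g y))" "bij (A (g y))" using inv' y f'[OF gy] by auto
    have "g' y (c *s v) = c *s g' y v" for c v
      by (metis A_scale g' bij_inv_eq_iff)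
    then show ?thesis using inv' y unfolding holo_map_at_def by blast
  qed
  moreover have "U \<subseteq> polydisc R" "bounded U" using inv(2) \<rho> bounded_subset[OF bounded_ball] by auto
  moreover have "L \<ge> 0" by (simp add: L_def)
  ultimately show thesis using that[of U V g L] inv lip by (auto simp: subset_iff)
qed

section \<open>The integrability estimate\<close>

text \<open>The value of the majorant series at its radius of summability \<open>r\<close> bounds
  every value on the closed polydisc of that radius.\<close>

lemma ps_eval_bounded:
  fixes G :: "'v::finite power_series"
  assumes "ps_convergent G"
  obtains r C where "r > 0" "C \<ge> 0" "\<And>w. (\<And>i. norm (w i) \<le> r) \<Longrightarrow> norm (ps_eval G w) \<le> C"
proof -
  obtain r where r: "r > 0" "(\<lambda>\<alpha>. norm (G \<alpha>) * r ^ (\<Sum>i\<in>UNIV. \<alpha> i)) summable_on UNIV"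
    using assms unfolding ps_convergent_def by blast
  define C where "C = (\<Sum>\<^sub>\<infinity>\<alpha>\<in>UNIV. norm (G \<alpha>) * r ^ (\<Sum>i\<in>UNIV. \<alpha> i))"
  have "norm (ps_eval G w) \<le> C" if w: "\<And>i. norm (w i) \<le> r" for w
  proof -
    have le: "norm (G \<alpha> * (\<Prod>i\<in>UNIV. w i ^ \<alpha> i)) \<le> norm (G \<alpha>) * r ^ (\<Sum>i\<in>UNIV. \<alpha> i)" for \<alpha>
    proof -
      have "(\<Prod>i\<in>UNIV. norm (w i) ^ \<alpha> i) \<le> (\<Prod>i\<in>UNIV. r ^ \<alpha> i)"
        by (intro prod_mono conjI power_mono w) auto
      then show ?thesis
        by (simp add: norm_mult prod_norm[symmetric] norm_power power_sum mult_left_mono)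
    qed
    have abs: "(\<lambda>\<alpha>. norm (G \<alpha> * (\<Prod>i\<in>UNIV. w i ^ \<alpha> i))) summable_on UNIV"
      by (rule Infinite_Sum.abs_summable_on_comparison_test'[OF r(2) le])
    have "norm (ps_eval G w) \<le> (\<Sum>\<^sub>\<infinity>\<alpha>\<in>UNIV. norm (G \<alpha> * (\<Prod>i\<in>UNIV. w i ^ \<alpha> i)))"
      unfolding ps_eval_def by (rule norm_infsum_bound[OF abs])
    also have "\<dots> \<le> C" unfolding C_def by (rule infsum_mono[OF abs r(2) le])
    finally show ?thesis .
  qed
  moreover have "C \<ge> 0" unfolding C_def using r(1) by (intro infsum_nonneg) simp
  ultimately show thesis using that r(1) by blast
qed

lemma ps_val_bound:
  fixes F :: "'v::finite power_series"
  assumes "enat k \<le> ps_val lam F" "k > 0"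
  shows "\<exists>\<epsilon>>0. \<exists>C\<ge>0. \<forall>x t. (\<forall>i. norm (x i) < \<epsilon>) \<and> norm t < \<epsilon> \<longrightarrow>
    norm (ps_eval F (\<lambda>i. t ^ lam i * x i)) \<le> C * norm t ^ k"
proof -
  \<comment> \<open>An admissible exponent \<open>k'\<close> strictly above \<open>k - 1\<close> is
    at least \<open>k\<close>; this extracts a witness from the supremum without showing that it is
    attained. Positivity of \<open>k\<close> makes the subtraction genuine.\<close>
  have "enat (k - 1) < ps_val lam F" using assms by (metis diff_less enat_ord_simps(2) less_le_trans zero_less_one)
  then obtain k' G \<epsilon> where k': "k - 1 < k'" and G: "ps_convergent G" and \<epsilon>: "\<epsilon> > 0"
    "\<And>x t. (\<forall>i. norm (x i) < \<epsilon>) \<and> norm t < \<epsilon> \<Longrightarrow>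
        ps_eval F (\<lambda>i. t ^ lam i * x i) = t ^ k' * ps_eval G (case_option t x)"
    unfolding ps_val_def less_Sup_iff by auto
  obtain r C where r: "r > 0" "C \<ge> 0" "\<And>w. (\<And>i. norm (w i) \<le> r) \<Longrightarrow> norm (ps_eval G w) \<le> C"
    using ps_eval_bounded[OF G] by blast
  \<comment> \<open>Below \<open>\<epsilon>\<close> the factorization holds, below \<open>r\<close>
    the cofactor \<open>G\<close> is bounded in both \<open>x\<close> and \<open>t\<close>, and
    below 1 the power \<open>k'\<close> may be lowered to \<open>k\<close>.\<close>
  define \<delta> where "\<delta> = min 1 (min \<epsilon> r)"
  have "norm (ps_eval F (\<lambda>i. t ^ lam i * x i)) \<le> C * norm t ^ k"
    if x: "\<forall>i. norm (x i) < \<delta>" "norm t < \<delta>" for x t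
  proof -
    have "ps_eval F (\<lambda>i. t ^ lam i * x i) = t ^ k' * ps_eval G (case_option t x)"
      by (rule \<epsilon>(2)) (use x in \<open>auto simp: \<delta>_def\<close>)
    moreover have "norm (ps_eval G (case_option t x)) \<le> C"
      by (rule r(3)) (use x in \<open>auto simp: \<delta>_def split: option.split intro: less_imp_le\<close>)
    moreover have "norm t ^ k' \<le> norm t ^ k"
      by (rule power_decreasing) (use k' x in \<open>auto simp: \<delta>_def\<close>)
    ultimately show ?thesis
      using mult_mono[of "norm t ^ k'" "norm t ^ k" "norm (ps_eval G (case_option t x))" C]
      by (simp add: norm_mult norm_power mult.commute)
  qed
  moreover have "\<delta> > 0" using \<epsilon>(1) r(1) by (simp add: \<delta>_def)
  ultimately show ?thesis using r(2) by blast
qed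

lemma powr_bounded_near_0_imp_nonneg:
  fixes a C \<epsilon> :: real
  assumes "\<epsilon> > 0" "\<And>t. 0 < t \<Longrightarrow> t < \<epsilon> \<Longrightarrow> t powr a \<le> C"
  shows "a \<ge> 0"
proof (rule ccontr)
  assume "\<not> a \<ge> 0"
  then have "filterlim (\<lambda>t::real. t powr a) at_top (at_right 0)" by real_asymp
  then have "\<forall>\<^sub>F t in at_right 0. C < t powr a" by (simp add: filterlim_at_top_dense)
  moreover have "\<forall>\<^sub>F t in at_right (0::real). 0 < t \<and> t < \<epsilon>"
    using assms(1) unfolding eventually_at_right_field by blast
  ultimately have "\<forall>\<^sub>F t in at_right (0::real). False"
    by eventually_elim (use assms(2) in force)
  then show False by simp
qed

lemma open_contains_polydisc:
  fixes V :: "(complex^'n) set"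
  assumes "open V" "0 \<in> V"
  obtains R where "R > 0" "polydisc R \<subseteq> V"
proof -
  obtain d where d: "d > 0" "ball 0 d \<subseteq> V" using assms open_contains_ball by blast
  have "polydisc (d / (2 * CARD('n))) \<subseteq> V"
  proof
    fix y :: "complex^'n" assume y: "y \<in> polydisc (d / (2 * CARD('n)))"
    have "norm y \<le> (\<Sum>i\<in>UNIV. norm (y $ i))" unfolding norm_vec_def by (rule L2_set_le_sum) simp
    also have "\<dots> \<le> (\<Sum>i\<in>(UNIV :: 'n set). d / (2 * CARD('n)))"
      by (rule sum_mono) (use polydiscD[OF y] in \<open>auto intro: less_imp_le\<close>)
    also have "\<dots> < d" using d by simp
    finally show "y \<in> V" using d by auto
  qed
  then show thesis using d(1) by (intro that[of "d / (2 * CARD('n))"]) auto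
qed

text \<open>The analytic core, free of power series: \<open>g\<close> stands for the sum of squared
  moduli, hence the exponent \<open>2 * k\<close>, and \<open>\<tau>\<close> for the coordinates
  given by the local parameters.\<close>

lemma integrability_exponent_bound:
  fixes \<tau> :: "complex^'n \<Rightarrow> complex^'n" and g :: "complex^'n \<Rightarrow> real"
  assumes N: "open N" "bounded N" "open V" "0 \<in> V" "homeomorphism N V \<tau> \<sigma>"
    and lip: "L \<ge> 0" "\<And>x y. x \<in> N \<Longrightarrow> y \<in> N \<Longrightarrow> norm (\<tau> x - \<tau> y) \<le> L * norm (x - y)"
    and s: "s > 0" and \<epsilon>: "\<epsilon> > 0" and A: "A > 0"
    and g: "\<And>z t. z \<in> N \<Longrightarrow> 0 < t \<Longrightarrow> t < \<epsilon> \<Longrightarrow> \<forall>i. norm (\<tau> z $ i) < t ^ lam i * \<epsilon> \<Longrightarrow>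
      0 \<le> g z \<and> g z \<le> A * t ^ (2 * k)"
    and fin: "(\<integral>\<^sup>+z\<in>N. 1 / ennreal (g z powr s) \<partial>lborel) < \<infinity>"
  shows "real k * s \<le> (\<Sum>i\<in>UNIV. real (lam i))"
proof -
  obtain I where I: "(\<integral>\<^sup>+z\<in>N. 1 / ennreal (g z powr s) \<partial>lborel) = ennreal I" "I \<ge> 0"
    using fin by (cases rule: ennreal_cases[of "\<integral>\<^sup>+z\<in>N. 1 / ennreal (g z powr s) \<partial>lborel"]) auto
  define K where "K = (2 * L * DIM(complex^'n)) ^ DIM(complex^'n)"
  have K: "K \<ge> 0" using lip(1) by (simp add: K_def)
  obtain d where d: "d > 0" "polydisc d \<subseteq> V" using open_contains_polydisc[OF N(3,4)] .
  \<comment> \<open>The one bound \<open>e\<close> limits both \<open>t\<close> and the box: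
    \<open>e \<le> d\<close> keeps the box in \<open>V\<close>, \<open>e \<le> 1\<close> makes the
    powers of \<open>t\<close> at most 1, and \<open>e \<le> \<epsilon>\<close> allows the estimate
    for \<open>g\<close>.\<close>
  define e where "e = min \<epsilon> (min 1 d)"
  have e: "e > 0" "e \<le> \<epsilon>" "e \<le> 1" "e \<le> d" using \<epsilon> d by (auto simp: e_def)
  have eV: "polydisc e \<subseteq> V" using polydisc_mono[OF e(4)] d(2) by (rule subset_trans)
  define m where "m = (\<Sum>i\<in>UNIV. lam i)"
  define c where "c = (\<Prod>i\<in>(UNIV :: 'n set). e\<^sup>2)"
  have c: "c > 0" using e unfolding c_def by (intro prod_pos) simp
  have "t powr (2 * real m - 2 * real k * s) \<le> K * I * A powr s / c" if t: "0 < t" "t < e" for t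
  proof -
    define Q where "Q = {y :: complex^'n. \<forall>i. norm (y $ i) < t ^ lam i * e}"
    have "t ^ lam i \<le> 1" for i using t e by (intro power_le_one) auto
    then have "t ^ lam i * e \<le> e" for i using e by simp
    then have Qe: "Q \<subseteq> polydisc e" unfolding Q_def polydisc_def by (auto intro: less_le_trans)
    have "open Q"
    proof -
      have "Q = (\<Inter>i. {y. norm (y $ i) < t ^ lam i * e})" by (auto simp: Q_def)
      moreover have "open {y :: complex^'n. norm (y $ i) < t ^ lam i * e}" for i
        by (intro open_Collect_less continuous_intros)
      ultimately show ?thesis by (simp add: open_INT)
    qed
    define S where "S = N \<inter> \<tau> -` Q"
    have \<tau>: "continuous_on N \<tau>" "\<tau> ` N = V" using N(5) by (auto simp: homeomorphism_def)
    have S: "open S" unfolding S_def by (rule continuous_open_preimage[OF \<tau>(1) N(1) \<open>open Q\<close>])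
    have "Q \<subseteq> \<tau> ` S" using \<tau>(2) Qe eV by (auto simp: S_def)
    moreover have "bounded S" using N(2) by (rule bounded_subset) (auto simp: S_def)
    moreover have "norm (\<tau> x - \<tau> y) \<le> L * norm (x - y)" if "x \<in> S" "y \<in> S" for x y
      by (rule lip(2)) (use that in \<open>auto simp: S_def\<close>)
    ultimately have "emeasure lborel Q \<le> ennreal K * emeasure lborel S"
      unfolding K_def by (intro Lipschitz_image_emeasure[OF S _ lip(1)])
    moreover have "ennreal (\<Prod>i\<in>UNIV. (t ^ lam i * e)\<^sup>2) \<le> emeasure lborel Q"
      unfolding Q_def by (rule emeasure_anisotropic_polydisc_ge) (use t e in simp)
    moreover have "(\<Prod>i\<in>UNIV. (t ^ lam i * e)\<^sup>2) = c * t ^ (2 * m)"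
      by (simp add: c_def m_def prod.distrib power_mult_distrib power_sum[symmetric] power_mult[symmetric]
          sum_distrib_right[symmetric] mult_ac)
    ultimately have vol: "ennreal (c * t ^ (2 * m)) \<le> ennreal K * emeasure lborel S" by simp
    define b where "b = (A * t ^ (2 * k)) powr s"
    have b: "b > 0" using A t by (simp add: b_def)
    have "ennreal (1 / b) * emeasure lborel S = (\<integral>\<^sup>+z. ennreal (1 / b) * indicator S z \<partial>lborel)"
      using S by (simp add: nn_integral_cmult_indicator)
    also have "\<dots> \<le> (\<integral>\<^sup>+z\<in>N. 1 / ennreal (g z powr s) \<partial>lborel)"
    proof (rule nn_integral_mono)
      fix z
      show "ennreal (1 / b) * indicator S z \<le> 1 / ennreal (g z powr s) * indicator N z"
      proof (cases "z \<in> S")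
        case True
        then have z: "z \<in> N" "\<forall>i. norm (\<tau> z $ i) < t ^ lam i * \<epsilon>"
          using e t by (auto simp: S_def Q_def intro: less_le_trans mult_left_mono)
        have "0 \<le> g z \<and> g z \<le> A * t ^ (2 * k)" by (rule g[OF z(1) t(1) _ z(2)]) (use t e in simp)
        then have "g z powr s \<le> b" unfolding b_def using s by (intro powr_mono2) auto
        \<comment> \<open>Where the denominator vanishes the integrand is infinite in
          \<open>ennreal\<close>, so the inequality also holds at common zeros.\<close>
        then have "1 / ennreal b \<le> 1 / ennreal (g z powr s)"
        proof (cases "g z powr s = 0")
          case False
          then have "g z powr s > 0" by (simp add: order_less_le)
          then show ?thesis using b \<open>g z powr s \<le> b\<close> divide_ennreal[of 1 b] divide_ennreal[of 1 "g z powr s"]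
            by (simp add: ennreal_leI frac_le)
        qed simp
        moreover have "ennreal (1 / b) = 1 / ennreal b" using b divide_ennreal[of 1 b] by simp
        ultimately show ?thesis using True z by simp
      qed simp
    qed
    also have "\<dots> = ennreal I" by (rule I(1))
    finally have int: "ennreal (1 / b) * emeasure lborel S \<le> ennreal I" .
    have "ennreal (1 / b) * ennreal (c * t ^ (2 * m)) \<le> ennreal K * (ennreal (1 / b) * emeasure lborel S)"
      using mult_left_mono[OF vol, of "ennreal (1 / b)"] by (simp add: mult_ac)
    also have "\<dots> \<le> ennreal K * ennreal I" by (rule mult_left_mono[OF int]) simp
    finally have "1 / b * (c * t ^ (2 * m)) \<le> K * I"
      using b c t K I(2) by (simp add: ennreal_mult[symmetric])
    moreover have "b = A powr s * t powr (2 * real k * s)"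
      unfolding b_def using A t by (simp add: powr_mult powr_powr powr_realpow[symmetric])
    moreover have "t ^ (2 * m) = t powr (2 * real m)" using t by (simp add: powr_realpow[symmetric])
    ultimately have "c * t powr (2 * real m) \<le> K * I * (A powr s * t powr (2 * real k * s))"
      using b by (simp add: field_simps)
    then have "t powr (2 * real m) / t powr (2 * real k * s) \<le> K * I * A powr s / c"
      using c t by (simp add: field_simps)
    then show ?thesis by (simp add: powr_diff)
  qed
  then have "2 * real m - 2 * real k * s \<ge> 0" using e(1) powr_bounded_near_0_imp_nonneg by blast
  then show ?thesis by (simp add: m_def)
qed

section \<open>Local parameters along a chart\<close>

text \<open>Polynomials are continuous, so the nonvanishing locus of \<open>h\<close> pulls back to
  a Euclidean neighbourhood in the chart.\<close>

lemma germ_eq_chart: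
  assumes ch: "holomorphic_chart X P U \<phi>" "z0 \<in> U" "\<phi> z0 = P" and g: "germ_eq X P f g"
  obtains W where "open W" "z0 \<in> W" "W \<subseteq> U" "\<And>z. z \<in> W \<Longrightarrow> f (\<phi> z) = g (\<phi> z)"
proof -
  obtain h where h: "h \<in> poly_fun" "h P \<noteq> 0" "\<And>x. x \<in> X \<Longrightarrow> h x \<noteq> 0 \<Longrightarrow> f x = g x"
    using g unfolding germ_eq_def by blast
  have U: "open U" "continuous_on U \<phi>" "\<phi> ` U \<subseteq> X"
    using ch(1) openin_imp_subset unfolding holomorphic_chart_def homeomorphism_def by blast+
  have "continuous_on UNIV h"
    using holo_at_imp_isCont[OF holo_at_poly_fun[OF h(1)]] by (simp add: continuous_at_imp_continuous_on)
  then have "continuous_on U (\<lambda>z. h (\<phi> z))"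
    using U(2) by (rule continuous_on_compose2) simp
  then have "open (U \<inter> (\<lambda>z. h (\<phi> z)) -` (- {0}))"
    using U(1) by (rule continuous_open_preimage) (rule open_Compl[OF closed_singleton])
  moreover have "f (\<phi> z) = g (\<phi> z)" if "z \<in> U \<inter> (\<lambda>z. h (\<phi> z)) -` (- {0})" for z
    by (rule h(3)) (use that U(3) in auto)
  ultimately show thesis using h(2) ch(2,3) by (intro that[of "U \<inter> (\<lambda>z. h (\<phi> z)) -` (- {0})"]) auto
qed

lemma chart_holo_map_at:
  assumes "holomorphic_chart X P U \<phi>" "z \<in> U"
  shows "holo_map_at \<phi> z"
  using assms unfolding holomorphic_chart_def holo_map_at_def by blast

lemma local_ring_chart:
  assumes ch: "holomorphic_chart X P U \<phi>" "z0 \<in> U" "\<phi> z0 = P" and f: "f \<in> local_ring X P"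
  obtains W where "open W" "z0 \<in> W" "W \<subseteq> U" "\<And>z. z \<in> W \<Longrightarrow> holo_at (\<lambda>z. f (\<phi> z)) z"
proof -
  obtain p q where pq: "p \<in> poly_fun" "q \<in> poly_fun" "q P \<noteq> 0" "germ_eq X P f (\<lambda>x. p x / q x)"
    using f unfolding local_ring_def by blast
  obtain W where W: "open W" "z0 \<in> W" "W \<subseteq> U" "\<And>z. z \<in> W \<Longrightarrow> f (\<phi> z) = p (\<phi> z) / q (\<phi> z)"
    using germ_eq_chart[OF ch pq(4)] by blast
  have q: "holo_at (\<lambda>z. q (\<phi> z)) z" and p: "holo_at (\<lambda>z. p (\<phi> z)) z" if "z \<in> W" for z
    using chart_holo_map_at[OF ch(1)] W(3) that holo_at_compose holo_at_poly_fun pq by blast+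
  have "continuous_on W (\<lambda>z. q (\<phi> z))"
    using holo_at_imp_isCont[OF q] by (simp add: continuous_at_imp_continuous_on)
  then have o: "open (W \<inter> (\<lambda>z. q (\<phi> z)) -` (- {0}))" (is "open ?W")
    using W(1) by (rule continuous_open_preimage) (rule open_Compl[OF closed_singleton])
  have "holo_at (\<lambda>z. f (\<phi> z)) z" if z: "z \<in> ?W" for z
    by (rule holo_at_cong_open[OF holo_at_divide[OF p q] o z]) (use z W(4) in auto)
  with o show thesis using W ch(3) pq(3) by (intro that[of ?W]) auto
qed

text \<open>Elements of the squared maximal ideal have zero derivative along the chart. Hence each
  ambient coordinate of \<open>E v\<close> is a linear combination of the coordinates of
  \<open>D v\<close>; if \<open>D v = 0\<close> then \<open>E v = 0\<close>, and the chart is an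
  immersion.\<close>

lemma chart_parameters_injective:
  fixes T :: "'n::finite \<Rightarrow> complex^'m \<Rightarrow> complex" and \<phi> :: "complex^'n \<Rightarrow> complex^'m"
  assumes ch: "holomorphic_chart X P U \<phi>" "z0 \<in> U" "\<phi> z0 = P" and T: "local_parameters X P T"
    and D: "((\<lambda>z. \<chi> i. T i (\<phi> z)) has_derivative D) (at z0)" and v: "D v = 0"
  shows "v = 0"
proof -
  obtain E where E: "(\<phi> has_derivative E) (at z0)" "inj E"
    using ch(1,2) unfolding holomorphic_chart_def by blast
  have D': "((\<lambda>z. T i (\<phi> z)) has_derivative (\<lambda>w. D w $ i)) (at z0)" for i
    using bounded_linear.has_derivative[OF bounded_linear_vec_nth D, of i] by simp
  have "E v $ j = 0" for j
  proof -
    \<comment> \<open>The ambient coordinate is centred at \<open>P\<close> so that it lies in the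
      maximal ideal.\<close>
    define f where "f = (\<lambda>x :: complex^'m. x $ j + (- (P $ j)))"
    have "f \<in> poly_fun" unfolding f_def by (intro poly_fun.intros)
    then have "f \<in> local_ring X P" unfolding local_ring_def
      by (intro CollectI bexI[of _ f] bexI[of _ "\<lambda>_. 1"])
        (auto simp: germ_eq_def intro!: poly_fun.const bexI[of _ "\<lambda>_. 1"])
    then have "f \<in> max_ideal X P" by (simp add: max_ideal_def f_def)
    then obtain c where "(\<lambda>q. f q - (\<Sum>i\<in>UNIV. c i * T i q)) \<in> max_ideal_sq X P"
      using T unfolding local_parameters_def cotangent_basis_def by blast
    then have "\<exists>(k::nat) a b. (\<forall>l<k. a l \<in> max_ideal X P \<and> b l \<in> max_ideal X P) \<and>
        germ_eq X P (\<lambda>q. f q - (\<Sum>i\<in>UNIV. c i * T i q)) (\<lambda>x. \<Sum>l<k. a l x * b l x)"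
      by (simp only: max_ideal_sq_def mem_Collect_eq)
    then obtain k :: nat and a b where ab: "\<forall>l<k. a l \<in> max_ideal X P \<and> b l \<in> max_ideal X P"
      and eq: "germ_eq X P (\<lambda>q. f q - (\<Sum>i\<in>UNIV. c i * T i q)) (\<lambda>x. \<Sum>l<k. a l x * b l x)"
      by (elim exE conjE) (rule that)
    obtain W where W: "open W" "z0 \<in> W"
      "\<And>z. z \<in> W \<Longrightarrow> f (\<phi> z) - (\<Sum>i\<in>UNIV. c i * T i (\<phi> z)) = (\<Sum>l<k. a l (\<phi> z) * b l (\<phi> z))"
    proof (rule germ_eq_chart[OF ch eq])
      fix W assume W: "open W" "z0 \<in> W"
        "\<And>z. z \<in> W \<Longrightarrow> f (\<phi> z) - (\<Sum>i\<in>UNIV. c i * T i (\<phi> z)) = (\<Sum>l<k. a l (\<phi> z) * b l (\<phi> z))"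
      show thesis by (rule that[OF W])
    qed
    have prod0: "((\<lambda>z. a l (\<phi> z) * b l (\<phi> z)) has_derivative (\<lambda>_. 0)) (at z0)" if l: "l < k" for l
    proof -
      have "\<exists>A. ((\<lambda>z. g (\<phi> z)) has_derivative A) (at z0)" if "g \<in> max_ideal X P" for g
      proof -
        from that have "g \<in> local_ring X P" by (simp add: max_ideal_def)
        then obtain W' where "z0 \<in> W'" "\<And>z. z \<in> W' \<Longrightarrow> holo_at (\<lambda>z. g (\<phi> z)) z"
          by (rule local_ring_chart[OF ch]) blast
        then show ?thesis unfolding holo_at_def by blast
      qed
      then obtain A B where AB: "((\<lambda>z. a l (\<phi> z)) has_derivative A) (at z0)" "((\<lambda>z. b l (\<phi> z)) has_derivative B) (at z0)"
        using ab l by blast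
      have "a l P = 0" "b l P = 0" using ab l by (auto simp: max_ideal_def)
      then show ?thesis using has_derivative_mult[OF AB] ch(3) by simp
    qed
    have sum0: "((\<lambda>z. \<Sum>l<k. a l (\<phi> z) * b l (\<phi> z)) has_derivative (\<lambda>_. \<Sum>l<k. 0)) (at z0)"
      by (rule has_derivative_sum) (simp add: prod0)
    have "((\<lambda>z. \<phi> z $ j) has_derivative (\<lambda>w. E w $ j)) (at z0)"
      using bounded_linear.has_derivative[OF bounded_linear_vec_nth E(1)] .
    then have "((\<lambda>z. f (\<phi> z)) has_derivative (\<lambda>w. E w $ j)) (at z0)"
      unfolding f_def using has_derivative_add_const by blast
    moreover have "((\<lambda>z. \<Sum>i\<in>UNIV. c i * T i (\<phi> z)) has_derivative (\<lambda>w. \<Sum>i\<in>UNIV. c i * D w $ i)) (at z0)"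
      by (intro has_derivative_sum has_derivative_mult_right D')
    ultimately have "((\<lambda>z. f (\<phi> z) - (\<Sum>i\<in>UNIV. c i * T i (\<phi> z))) has_derivative
        (\<lambda>w. E w $ j - (\<Sum>i\<in>UNIV. c i * D w $ i))) (at z0)"
      by (rule has_derivative_diff)
    then have "((\<lambda>z. \<Sum>l<k. a l (\<phi> z) * b l (\<phi> z)) has_derivative
        (\<lambda>w. E w $ j - (\<Sum>i\<in>UNIV. c i * D w $ i))) (at z0)"
      by (rule has_derivative_transform_within_open[OF _ W])
    \<comment> \<open>Near \<open>z0\<close> both sides of the congruence modulo the squared ideal
      are the same function, so their derivatives agree.\<close>
    from has_derivative_unique[OF this sum0]
    have "E v $ j - (\<Sum>i\<in>UNIV. c i * D v $ i) = (\<Sum>l<k. 0)" by (rule fun_cong)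
    then show ?thesis using v by simp
  qed
  then have "E v = 0" by (simp add: vec_eq_iff)
  moreover have "linear E" using E(1) has_derivative_linear by blast
  ultimately show ?thesis using E(2) linear_injective_0 by blast
qed

text \<open>The inverse function theorem above is centred at the origin, hence the translation by
  \<open>z0\<close>. The target contains 0 because all parameters vanish at
  \<open>P\<close>.\<close>

lemma local_parameter_coordinates:
  fixes T :: "'n::finite \<Rightarrow> complex^'m \<Rightarrow> complex" and \<phi> :: "complex^'n \<Rightarrow> complex^'m"
  assumes ch: "holomorphic_chart X P U \<phi>" "z0 \<in> U" "\<phi> z0 = P" and T: "local_parameters X P T"
  obtains N V \<sigma> L where "open N" "z0 \<in> N" "N \<subseteq> U" "bounded N" "open V" "0 \<in> V"
    "homeomorphism N V (\<lambda>z. \<chi> i. T i (\<phi> z)) \<sigma>" "\<And>y. y \<in> V \<Longrightarrow> holo_map_at \<sigma> y" "L \<ge> 0"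
    "\<And>x y. x \<in> N \<Longrightarrow> y \<in> N \<Longrightarrow> norm ((\<chi> i. T i (\<phi> x)) - (\<chi> i. T i (\<phi> y))) \<le> L * norm (x - y)"
proof -
  have TP: "T i \<in> local_ring X P" "T i P = 0" for i
    using T by (auto simp: local_parameters_def cotangent_basis_def max_ideal_def)
  have "\<exists>W. open W \<and> z0 \<in> W \<and> W \<subseteq> U \<and> (\<forall>z\<in>W. holo_at (\<lambda>z. T i (\<phi> z)) z)" for i
    using local_ring_chart[OF ch TP(1)[of i]] by metis
  then obtain W where W: "\<And>i. open (W i)" "\<And>i. z0 \<in> W i" "\<And>i. W i \<subseteq> U"
    "\<And>i z. z \<in> W i \<Longrightarrow> holo_at (\<lambda>z. T i (\<phi> z)) z" by metis
  have "open ((+) (- z0) ` (\<Inter>i. W i))" using W(1) by (intro open_translation open_INT) auto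
  moreover have "0 \<in> (+) (- z0) ` (\<Inter>i. W i)" using W(2) by (auto intro!: image_eqI[of _ _ z0])
  ultimately obtain R where R: "R > 0" "polydisc R \<subseteq> (+) (- z0) ` (\<Inter>i. W i)"
    by (rule open_contains_polydisc)
  have RW: "z0 + z \<in> W i" if "z \<in> polydisc R" for z i using R(2) that by auto
  define \<tau> where "\<tau> z = (\<chi> i. T i (\<phi> (z0 + z)))" for z
  have hol: "holo_at (\<lambda>z. \<tau> z $ i) z" if "z \<in> polydisc R" for z i
  proof -
    have "holo_at (\<lambda>z. T i (\<phi> z)) (z0 + z)" using RW[OF that] W(4) by blast
    from holo_at_compose[OF this holo_map_at_translate] show ?thesis by (simp add: \<tau>_def)
  qed
  have "\<exists>D. ((\<lambda>z. T i (\<phi> z)) has_derivative D) (at z0)" for i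
    using W(2,4) unfolding holo_at_def by blast
  then obtain D' where "\<And>i. ((\<lambda>z. T i (\<phi> z)) has_derivative D' i) (at z0)" by metis
  then have D: "((\<lambda>z. \<chi> i. T i (\<phi> z)) has_derivative (\<lambda>w. \<chi> i. D' i w)) (at z0)"
    by (intro has_derivative_vec_componentwise) simp
  have tr: "((\<lambda>z. z0 + z) has_derivative (\<lambda>w. w)) (at 0)"
    using has_derivative_add[OF has_derivative_const has_derivative_ident] by simp
  have der: "(\<tau> has_derivative (\<lambda>w. \<chi> i. D' i w)) (at 0)"
    unfolding \<tau>_def by (rule has_derivative_compose[OF tr]) (use D in simp)
  show thesis
  proof (rule holomorphic_local_inverse[OF R(1) hol der chart_parameters_injective[OF ch T D]])
    fix U' V g L
    assume loc: "open U'" "0 \<in> U'" "U' \<subseteq> polydisc R" "bounded U'" "open V" "\<tau> 0 \<in> V"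
      "homeomorphism U' V \<tau> g" "\<And>y. y \<in> V \<Longrightarrow> holo_map_at g y" "L \<ge> 0"
      "\<And>x y. x \<in> U' \<Longrightarrow> y \<in> U' \<Longrightarrow> norm (\<tau> x - \<tau> y) \<le> L * norm (x - y)"
    show thesis
    proof (rule that)
      show "open ((+) z0 ` U')" "bounded ((+) z0 ` U')" "z0 \<in> (+) z0 ` U'"
        using loc by (auto intro: open_translation bounded_translation image_eqI[of _ _ 0])
      show "(+) z0 ` U' \<subseteq> U" using loc(3) RW W(3) by blast
      have "homeomorphism ((+) z0 ` U') V (\<tau> \<circ> (+) (- z0)) ((+) z0 \<circ> g)"
        by (rule homeomorphism_compose[OF homeomorphism_translation loc(7)])
      moreover have "\<tau> \<circ> (+) (- z0) = (\<lambda>z. \<chi> i. T i (\<phi> z))" by (simp add: \<tau>_def fun_eq_iff)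
      ultimately show "homeomorphism ((+) z0 ` U') V (\<lambda>z. \<chi> i. T i (\<phi> z)) ((+) z0 \<circ> g)" by simp
      show "holo_map_at ((+) z0 \<circ> g) y" if "y \<in> V" for y
        unfolding o_def by (rule holo_map_at_compose[OF holo_map_at_translate loc(8)[OF that]])
      show "norm ((\<chi> i. T i (\<phi> x)) - (\<chi> i. T i (\<phi> y))) \<le> L * norm (x - y)"
        if "x \<in> (+) z0 ` U'" "y \<in> (+) z0 ` U'" for x y
      proof -
        obtain x' y' where "x = z0 + x'" "y = z0 + y'" "x' \<in> U'" "y' \<in> U'" using \<open>x \<in> _\<close> \<open>y \<in> _\<close> by blast
        then show ?thesis using loc(10)[of x' y'] by (simp add: \<tau>_def)
      qed
      have "\<tau> 0 = 0" by (simp add: \<tau>_def ch(3) TP(2) vec_eq_iff)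
      then show "0 \<in> V" using loc(6) by simp
    qed (use loc(5,9) in auto)
  qed
qed

text \<open>The order of the ideal ranges only over existing expansions, so each generator needs
  one. The polynomial behind \<open>f\<close>, read in the coordinates \<open>y = T\<close>, is the
  holomorphic function \<open>p (\<phi> (\<sigma> y))\<close>, which has a convergent
  series.\<close>

lemma expansion_exists:
  fixes T :: "'n::finite \<Rightarrow> complex^'m \<Rightarrow> complex" and \<phi> :: "complex^'n \<Rightarrow> complex^'m"
  assumes ch: "holomorphic_chart X P U \<phi>" "z0 \<in> U" "\<phi> z0 = P" and T: "local_parameters X P T"
    and f: "f \<in> carrier (coordinate_ring X)"
  shows "\<exists>F. is_expansion X P T f F"
proof -
  obtain p where p: "p \<in> poly_fun" "\<And>x. x \<in> X \<Longrightarrow> f x = p x"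
    using f unfolding carrier_coordinate_ring by auto
  show ?thesis
  proof (rule local_parameter_coordinates[OF ch T])
    fix N V \<sigma> L
    assume N: "open N" "z0 \<in> N" "N \<subseteq> U" "open V" "0 \<in> V"
      and hom: "homeomorphism N V (\<lambda>z. \<chi> i. T i (\<phi> z)) \<sigma>" and \<sigma>: "\<And>y. y \<in> V \<Longrightarrow> holo_map_at \<sigma> y"
    let ?\<tau> = "\<lambda>z. \<chi> i. T i (\<phi> z)"
    obtain R where R: "R > 0" "polydisc R \<subseteq> V" using open_contains_polydisc[OF N(4,5)] .
    have "holo_at (\<lambda>y. p (\<phi> (\<sigma> y))) y" if "y \<in> polydisc R" for y
    proof -
      have y: "y \<in> V" using that R by blast
      then have "\<sigma> y \<in> U" using hom N(3) by (auto simp: homeomorphism_def)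
      then have "holo_map_at (\<lambda>y. \<phi> (\<sigma> y)) y" by (intro holo_map_at_compose[OF _ \<sigma>[OF y]] chart_holo_map_at[OF ch(1)])
      then show ?thesis by (rule holo_at_compose[OF holo_at_poly_fun[OF p(1)]])
    qed
    then have "separately_holomorphic R (\<lambda>y. p (\<phi> (\<sigma> y)))" by (rule separately_holomorphicI)
    then obtain F where F: "ps_convergent F" "\<forall>y\<in>polydisc (R / 2). p (\<phi> (\<sigma> y)) = ps_eval F (\<lambda>i. y $ i)"
      using R(1) by (elim separately_holomorphic_expansion[where r = "R / 2"]) auto
    define S where "S = N \<inter> ?\<tau> -` polydisc (R / 2)"
    have "continuous_on N ?\<tau>" using hom by (simp add: homeomorphism_def)
    then have S: "open S" unfolding S_def using N(1) open_polydisc by (rule continuous_open_preimage)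
    \<comment> \<open>An expansion must hold on an ambient open set cut with \<open>X\<close>. The
      chart is a homeomorphism onto a relatively open set, so the image of \<open>S\<close> is
      relatively open in \<open>X\<close> and has the form \<open>X \<inter> B\<close>.\<close>
    obtain \<psi> where \<psi>: "homeomorphism U (\<phi> ` U) \<phi> \<psi>" and U: "openin (top_of_set X) (\<phi> ` U)"
      using ch(1) unfolding holomorphic_chart_def by blast
    have "U \<inter> S = S" using N(3) by (auto simp: S_def)
    then have "openin (top_of_set U) S" using openin_open_Int[OF S, of U] by simp
    then have "openin (top_of_set (\<phi> ` U)) (\<phi> ` S)" by (rule homeomorphism_imp_open_map[OF \<psi>])
    then have "openin (top_of_set X) (\<phi> ` S)" using U by (rule openin_trans)
    then obtain B where B: "open B" "\<phi> ` S = X \<inter> B" unfolding openin_open by blast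
    have "T i P = 0" for i using T by (simp add: local_parameters_def cotangent_basis_def max_ideal_def)
    then have "z0 \<in> S" using N(2) R(1) ch(3) by (simp add: S_def polydisc_def)
    then have "P \<in> B" using B(2) ch(3) by blast
    moreover have "f q = ps_eval F (\<lambda>i. T i q)" if "q \<in> B \<inter> X" for q
    proof -
      have "q \<in> \<phi> ` S" using that unfolding B(2) by simp
      then obtain z where z: "z \<in> S" "q = \<phi> z" by (elim imageE)
      then have "z \<in> N" "?\<tau> z \<in> polydisc (R / 2)" by (auto simp: S_def)
      then have "p (\<phi> (\<sigma> (?\<tau> z))) = ps_eval F (\<lambda>i. ?\<tau> z $ i)" using F(2) by blast
      moreover have "\<sigma> (?\<tau> z) = z" using hom \<open>z \<in> N\<close> by (simp add: homeomorphism_def)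
      ultimately show ?thesis using p(2) that z(2) by simp
    qed
    ultimately show ?thesis unfolding is_expansion_def using F(1) B(1) by blast
  qed
qed

text \<open>Transfers the bounds on the series to the generators in the chart, where the analytic
  estimate applies.\<close>

lemma stable_rank_inequality:
  fixes T :: "'n::finite \<Rightarrow> complex^'m \<Rightarrow> complex" and \<phi> :: "complex^'n \<Rightarrow> complex^'m"
    and r :: nat
  assumes ch: "holomorphic_chart X P U \<phi>" and T: "local_parameters X P T"
    and F: "\<And>i. i < r \<Longrightarrow> is_expansion X P T (f i) (F i)"
    and val: "\<And>i. i < r \<Longrightarrow> enat k \<le> ps_val lam (F i)"
    and k: "k > 0" and s: "s > 0"
    and fin: "(\<integral>\<^sup>+z\<in>U. 1 / ennreal ((\<Sum>i<r. (norm (f i (\<phi> z)))\<^sup>2) powr s) \<partial>lborel) < \<infinity>"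
  shows "real k * s \<le> (\<Sum>i\<in>UNIV. real (lam i))"
proof -
  obtain z0 where z0: "z0 \<in> U" "\<phi> z0 = P" using ch unfolding holomorphic_chart_def by blast
  let ?\<tau> = "\<lambda>z. \<chi> i. T i (\<phi> z)"
  have U: "open U" "continuous_on U \<phi>" "\<phi> ` U \<subseteq> X"
    using ch openin_imp_subset unfolding holomorphic_chart_def homeomorphism_def by blast+
  have "\<forall>i. \<exists>B. i < r \<longrightarrow> open B \<and> P \<in> B \<and> (\<forall>q\<in>B \<inter> X. f i q = ps_eval (F i) (\<lambda>j. T j q))"
    using F unfolding is_expansion_def by blast
  then obtain B where B: "\<And>i. i < r \<Longrightarrow> open (B i)" "\<And>i. i < r \<Longrightarrow> P \<in> B i"
    "\<And>i q. i < r \<Longrightarrow> q \<in> B i \<Longrightarrow> q \<in> X \<Longrightarrow> f i q = ps_eval (F i) (\<lambda>j. T j q)"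
    unfolding choice_iff by blast
  define B' where "B' = (\<Inter>i\<in>{..<r}. B i)"
  have "open B'" unfolding B'_def by (rule open_INT) (use B(1) in auto)
  moreover have "P \<in> B'" using B(2) by (simp add: B'_def)
  ultimately have B': "open B'" "P \<in> B'" .
  define Q where "Q i e c \<longleftrightarrow> e > 0 \<and> c \<ge> 0 \<and> (\<forall>x t. (\<forall>j. norm (x j) < e) \<and> norm t < e \<longrightarrow>
    norm (ps_eval (F i) (\<lambda>j. t ^ lam j * x j)) \<le> c * norm t ^ k)" for i and e c :: real
  have "\<exists>e c. i < r \<longrightarrow> Q i e c" for i
    using ps_val_bound[OF val k, of i] unfolding Q_def by blast
  then have "\<exists>E C. \<forall>i. i < r \<longrightarrow> Q i (E i) (C i)" by metis
  then obtain E C where EC: "\<And>i. i < r \<Longrightarrow> Q i (E i) (C i)" by blast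
  \<comment> \<open>Inserting 1 keeps the minimum meaningful for \<open>r = 0\<close>; likewise the
    summand 1 in \<open>A\<close> keeps it positive when all \<open>C i\<close> vanish.\<close>
  define \<epsilon> where "\<epsilon> = Min (insert 1 (E ` {..<r}))"
  have \<epsilon>: "\<epsilon> > 0" "\<And>i. i < r \<Longrightarrow> \<epsilon> \<le> E i" using EC by (auto simp: \<epsilon>_def Q_def)
  define A where "A = 1 + (\<Sum>i<r. (C i)\<^sup>2)"
  have A: "A > 0" unfolding A_def by (intro add_pos_nonneg sum_nonneg) auto
  show ?thesis
  proof (rule local_parameter_coordinates[OF ch z0 T])
    fix N V \<sigma> L
    assume N: "open N" "z0 \<in> N" "N \<subseteq> U" "bounded N" "open V" "0 \<in> V"
      and hom: "homeomorphism N V ?\<tau> \<sigma>" and L: "L \<ge> 0"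
      and lip: "\<And>x y. x \<in> N \<Longrightarrow> y \<in> N \<Longrightarrow> norm (?\<tau> x - ?\<tau> y) \<le> L * norm (x - y)"
    \<comment> \<open>Shrinks the coordinate neighbourhood to points whose images lie where all the
      expansions are valid.\<close>
    define M where "M = N \<inter> \<phi> -` B'"
    have "continuous_on N \<phi>" using U(2) N(3) by (rule continuous_on_subset)
    then have M: "open M" unfolding M_def using N(1) B'(1) by (rule continuous_open_preimage)
    have "N \<inter> M = M" by (auto simp: M_def)
    then have "openin (top_of_set N) M" using openin_open_Int[OF M, of N] by simp
    then have "openin (top_of_set V) (?\<tau> ` M)" by (rule homeomorphism_imp_open_map[OF hom])
    then have \<tau>M: "open (?\<tau> ` M)" using N(5) by (rule openin_open_trans)
    have "T i P = 0" for i using T by (simp add: local_parameters_def cotangent_basis_def max_ideal_def)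
    then have "?\<tau> z0 = 0" by (simp add: z0(2) vec_eq_iff)
    moreover have "z0 \<in> M" using N(2) B'(2) z0(2) by (simp add: M_def)
    ultimately have 0: "0 \<in> ?\<tau> ` M" by (intro image_eqI[of 0 ?\<tau> z0]) simp_all
    have homM: "homeomorphism M (?\<tau> ` M) ?\<tau> \<sigma>"
      by (rule homeomorphism_of_subsets[OF hom]) (auto simp: M_def)
    have "(\<integral>\<^sup>+z\<in>M. 1 / ennreal ((\<Sum>i<r. (norm (f i (\<phi> z)))\<^sup>2) powr s) \<partial>lborel)
        \<le> (\<integral>\<^sup>+z\<in>U. 1 / ennreal ((\<Sum>i<r. (norm (f i (\<phi> z)))\<^sup>2) powr s) \<partial>lborel)"
      using N(3) by (intro nn_integral_mono) (auto simp: M_def indicator_def)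
    then have finM: "(\<integral>\<^sup>+z\<in>M. 1 / ennreal ((\<Sum>i<r. (norm (f i (\<phi> z)))\<^sup>2) powr s) \<partial>lborel) < \<infinity>"
      using fin by (rule order_le_less_trans)
    show ?thesis
    proof (rule integrability_exponent_bound[OF M _ \<tau>M 0 homM L _ s \<epsilon>(1) A _ finM])
      show "bounded M" using N(4) by (rule bounded_subset) (auto simp: M_def)
      show "norm (?\<tau> x - ?\<tau> y) \<le> L * norm (x - y)" if "x \<in> M" "y \<in> M" for x y
        by (rule lip) (use that in \<open>auto simp: M_def\<close>)
      fix z and t :: real
      assume z: "z \<in> M" and t: "0 < t" "t < \<epsilon>" and box: "\<forall>i. norm (?\<tau> z $ i) < t ^ lam i * \<epsilon>"
      have "norm (f i (\<phi> z)) \<le> C i * t ^ k" if i: "i < r" for i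
      proof -
        have "f i (\<phi> z) = ps_eval (F i) (\<lambda>j. T j (\<phi> z))"
          by (rule B(3)[OF i]) (use z i N(3) U(3) in \<open>auto simp: M_def B'_def\<close>)
        \<comment> \<open>A point of the box is rescaled to \<open>x\<close> with entries below
          \<open>\<epsilon>\<close>, which puts the parameters into the weighted form of the
          valuation bound.\<close>
        also have "(\<lambda>j. T j (\<phi> z)) = (\<lambda>j. complex_of_real t ^ lam j * (T j (\<phi> z) / complex_of_real t ^ lam j))"
          using t by simp
        also have "norm (ps_eval (F i) \<dots>) \<le> C i * norm (complex_of_real t) ^ k"
        proof (rule EC[OF i, unfolded Q_def, THEN conjunct2, THEN conjunct2, rule_format], intro conjI)
          have "norm (T j (\<phi> z) / complex_of_real t ^ lam j) < \<epsilon>" for j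
            using box t by (simp add: norm_divide norm_power divide_less_eq mult.commute)
          then show "\<forall>j. norm (T j (\<phi> z) / complex_of_real t ^ lam j) < E i"
            using \<epsilon>(2)[OF i] less_le_trans by blast
          show "norm (complex_of_real t) < E i" using t \<epsilon>(2)[OF i] by simp
        qed
        finally show ?thesis using t by simp
      qed
      then have "(\<Sum>i<r. (norm (f i (\<phi> z)))\<^sup>2) \<le> (\<Sum>i<r. (C i * t ^ k)\<^sup>2)"
        by (intro sum_mono power_mono) auto
      also have "\<dots> = (\<Sum>i<r. (C i)\<^sup>2) * t ^ (2 * k)"
        by (simp add: power_mult_distrib sum_distrib_right mult.commute[of k 2] flip: power_mult)
      also have "\<dots> \<le> A * t ^ (2 * k)" unfolding A_def using t by (intro mult_right_mono) auto
      finally show "0 \<le> (\<Sum>i<r. (norm (f i (\<phi> z)))\<^sup>2) \<and> (\<Sum>i<r. (norm (f i (\<phi> z)))\<^sup>2) \<le> A * t ^ (2 * k)"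
        by (simp add: sum_nonneg)
    qed
  qed
qed

text \<open>Order 0 makes the quotient infinite since \<open>m > 0\<close>; a positive finite order
  is itself an admissible \<open>k\<close>; an infinite order would admit every \<open>k\<close>,
  against the Archimedean property.\<close>

lemma le_divide_ennreal_of_enat:
  assumes s: "s > 0" and m: "m > 0" and *: "\<And>k::nat. k > 0 \<Longrightarrow> enat k \<le> d \<Longrightarrow> real k * s \<le> real m"
  shows "ennreal s \<le> of_nat m / ennreal_of_enat d"
proof (cases d)
  case (enat k)
  show ?thesis
  proof (cases "k = 0")
    case True
    then show ?thesis using enat m by (simp add: ennreal_divide_zero)
  next
    case False
    then have "s \<le> real m / real k" using *[of k] enat by (simp add: field_simps)
    then have "ennreal s \<le> ennreal (real m / real k)" by (rule ennreal_leI)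
    also have "\<dots> = of_nat m / ennreal_of_enat d"
      using False enat by (simp add: divide_ennreal[symmetric] ennreal_of_nat_eq_real_of_nat)
    finally show ?thesis .
  qed
next
  case infinity
  obtain k :: nat where k: "real m / s < real k" using reals_Archimedean2 by blast
  moreover have "0 < real m / s" using s m by simp
  ultimately have "k > 0" by (metis less_trans of_nat_0_less_iff)
  then have "real k * s \<le> real m" using infinity by (intro *) auto
  then show ?thesis using k s by (simp add: field_simps)
qed

theorem theorem9:
  fixes X :: "(complex^'m) set" and P :: "complex^'m"
    and r :: nat and f :: "nat \<Rightarrow> complex^'m \<Rightarrow> complex"
    and \<aa> :: "(complex^'m \<Rightarrow> complex) set"
  assumes "smooth_irreducible_affine_variety X"
    and "variety_dim X = enat CARD('n::finite)"
    and "\<And>i. i < r \<Longrightarrow> f i \<in> carrier (coordinate_ring X)"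
    and "\<aa> = genideal (coordinate_ring X) (f ` {..<r})"
    and "\<aa> \<noteq> {\<zero>\<^bsub>coordinate_ring X\<^esub>}"
    and "P \<in> X" and "\<And>g. g \<in> \<aa> \<Longrightarrow> g P = 0"
  shows "lct TYPE('n) X P r f \<le> G_stable_rank TYPE('n) X P \<aa>"
  unfolding lct_def G_stable_rank_def T_stable_rank_def
proof (intro SUP_least INF_greatest)
  fix s and T :: "'n \<Rightarrow> complex^'m \<Rightarrow> complex" and lam :: "'n \<Rightarrow> nat"
  assume s: "s \<in> {s. s > 0 \<and> locally_integrable_power TYPE('n) X P r f s}"
    and "T \<in> {T. local_parameters X P T}" and lam: "lam \<in> {lam. \<exists>i. lam i \<noteq> 0}"
  then have T: "local_parameters X P T" by simp
  obtain U :: "(complex^'n) set" and \<phi> where ch: "holomorphic_chart X P U \<phi>"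
    and fin: "(\<integral>\<^sup>+z\<in>U. 1 / ennreal ((\<Sum>i<r. (norm (f i (\<phi> z)))\<^sup>2) powr s) \<partial>lborel) < \<infinity>"
    using s unfolding locally_integrable_power_def by blast
  obtain z0 where z0: "z0 \<in> U" "\<phi> z0 = P" using ch unfolding holomorphic_chart_def by blast
  have "\<forall>i. \<exists>F. i < r \<longrightarrow> is_expansion X P T (f i) F"
    using expansion_exists[OF ch z0 T assms(3)] by blast
  then obtain F where F: "\<And>i. i < r \<Longrightarrow> is_expansion X P T (f i) (F i)" unfolding choice_iff by blast
  interpret cring "coordinate_ring X" by (rule cring_coordinate_ring)
  \<comment> \<open>The generators belong to the ideal, so each of their expansions competes in the
    infimum and has at least the order of the ideal.\<close>
  have "f ` {..<r} \<subseteq> \<aa>" unfolding assms(4) by (rule genideal_self) (use assms(3) in auto)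
  then have val: "ideal_ord X P T lam \<aa> \<le> ps_val lam (F i)" if "i < r" for i
    unfolding ideal_ord_def using F[OF that] that by (intro INF_lower) blast
  obtain i0 where "lam i0 \<noteq> 0" using lam by blast
  then have m: "(\<Sum>i\<in>UNIV. lam i) > 0" using member_le_sum[of i0 UNIV lam] by simp
  show "ennreal s \<le> of_nat (\<Sum>i\<in>UNIV. lam i) / ennreal_of_enat (ideal_ord X P T lam \<aa>)"
  proof (rule le_divide_ennreal_of_enat[OF _ m])
    show "s > 0" using s by simp
    fix k :: nat assume k: "k > 0" "enat k \<le> ideal_ord X P T lam \<aa>"
    have "real k * s \<le> (\<Sum>i\<in>UNIV. real (lam i))"
    proof (rule stable_rank_inequality[OF ch T F _ k(1) _ fin])
      show "enat k \<le> ps_val lam (F i)" if "i < r" for i using k(2) val[OF that] by (rule order_trans)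
    qed (use s in auto)
    then show "real k * s \<le> real (\<Sum>i\<in>UNIV. lam i)" by simp
  qed
qed

end
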